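(* Given a tournament $T$ on $n$ vertices, one can decide whether $\operatorname{inv}(T)\leq 2$ in $O(n^6)$ time.
   Context: Inverting a vertex set $X$ of a tournament means reversing every arc with both ends in $X$; $\operatorname{inv}(T)$ is the minimum number of successive inversions needed to make $T$ acyclic (i.e., transitive). *)

theory Defs
  imports Complex_Main "HOL-Library.Landau_Symbols"
begin

definition tournament :: "'a set \<Rightarrow> 'a rel \<Rightarrow> bool" where
  "tournament V A \<longleftrightarrow> finite V \<and> A \<subseteq> V \<times> V \<and> asym A \<and> total_on V A"

definition invert :: "'a rel \<Rightarrow> 'a set \<Rightarrow> 'a rel" where
  "invert A X = (A - X \<times> X) \<union> (A \<inter> X \<times> X)\<inverse>"

text \<open>The minimum is over a nonempty set for every tournament: inverting a two-element set
  reverses a single arc.\<close>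

definition inv_number :: "'a set \<Rightarrow> 'a rel \<Rightarrow> nat" where
  "inv_number V A = (LEAST k. \<exists>Xs. length Xs = k \<and> (\<forall>X\<in>set Xs. X \<subseteq> V) \<and>
     acyclic (foldl invert A Xs))"

text \<open>The machine model is the unit-cost word RAM, with structured control flow instead of jumps.
  A state is a pair of register contents and memory contents. Each program mentions only finitely
  many registers; memory is accessed indirectly, through addresses held in registers.\<close>

type_synonym ram_state = "(nat \<Rightarrow> nat) \<times> (nat \<Rightarrow> nat)"

datatype ram =
    Const nat nat
  | Add nat nat nat
  | Sub nat nat nat
  | Mul nat nat nat
  | Load nat nat
  | Store nat nat
  | Seq ram ram
  | IfLess nat nat ram ram
  | WhileLess nat nat ram

text \<open>\<open>exec B p s t s'\<close>: started in \<open>s\<close>, program \<open>p\<close> halts in \<open>s'\<close> after \<open>t\<close> steps, where every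
  instruction and every evaluation of a test is one step. Words hold the numbers below \<open>B\<close>; an
  instruction whose result does not fit into a word has no transition, so large numbers cannot be
  exploited to do much work in a single step. Subtraction is truncated at 0.\<close>

inductive exec :: "nat \<Rightarrow> ram \<Rightarrow> ram_state \<Rightarrow> nat \<Rightarrow> ram_state \<Rightarrow> bool" for B :: nat where
  Const: "c < B \<Longrightarrow> exec B (Const r c) (R, M) 1 (R(r := c), M)"
| Add: "R x + R y < B \<Longrightarrow> exec B (Add r x y) (R, M) 1 (R(r := R x + R y), M)"
| Sub: "exec B (Sub r x y) (R, M) 1 (R(r := R x - R y), M)"
| Mul: "R x * R y < B \<Longrightarrow> exec B (Mul r x y) (R, M) 1 (R(r := R x * R y), M)"
| Load: "exec B (Load r x) (R, M) 1 (R(r := M (R x)), M)"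
| Store: "exec B (Store x r) (R, M) 1 (R, M(R x := R r))"
| Seq: "exec B p s t s' \<Longrightarrow> exec B q s' u s'' \<Longrightarrow> exec B (Seq p q) s (t + u) s''"
| IfTrue: "fst s x < fst s y \<Longrightarrow> exec B p s t s' \<Longrightarrow> exec B (IfLess x y p q) s (1 + t) s'"
| IfFalse: "\<not> fst s x < fst s y \<Longrightarrow> exec B q s t s' \<Longrightarrow> exec B (IfLess x y p q) s (1 + t) s'"
| WhileFalse: "\<not> fst s x < fst s y \<Longrightarrow> exec B (WhileLess x y p) s 1 s"
| WhileTrue: "fst s x < fst s y \<Longrightarrow> exec B p s t s' \<Longrightarrow> exec B (WhileLess x y p) s' u s'' \<Longrightarrow>
    exec B (WhileLess x y p) s (1 + t + u) s''"

inductive_cases exec_elims: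
  "exec B (Const r c) s t s'" "exec B (Add r x y) s t s'" "exec B (Sub r x y) s t s'"
  "exec B (Mul r x y) s t s'" "exec B (Load r x) s t s'" "exec B (Store x r) s t s'"

inductive_cases exec_SeqE: "exec B (Seq p q) s t s'"
inductive_cases exec_IfE: "exec B (IfLess x y p q) s t s'"
inductive_cases exec_WhileE: "exec B (WhileLess x y p) s t s'"

lemma exec_deterministic:
  "exec B p s t s' \<Longrightarrow> exec B p s u s'' \<Longrightarrow> u = t \<and> s'' = s'"
proof (induction arbitrary: u s'' rule: exec.induct)
  case (Seq p s t s1 q v s2)
  from Seq.prems show ?case
  proof (rule exec_SeqE)
    fix t' s' u' assume *: "u = t' + u'" "exec B p s t' s'" "exec B q s' u' s''"
    from Seq.IH(1)[OF *(2)] Seq.IH(2)[of u' s''] * show ?thesis by simp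
  qed
next
  case (IfTrue s x y p t s1 q)
  from IfTrue.prems show ?case
  proof (rule exec_IfE)
    fix t' assume *: "u = Suc t'" "exec B p s t' s''"
    from IfTrue.IH[OF *(2)] * show ?thesis by simp
  qed (use IfTrue.hyps in blast)
next
  case (IfFalse s x y q t s1 p)
  from IfFalse.prems show ?case
  proof (rule exec_IfE)
    fix t' assume *: "u = Suc t'" "exec B q s t' s''"
    from IfFalse.IH[OF *(2)] * show ?thesis by simp
  qed (use IfFalse.hyps in blast)
next
  case (WhileFalse s x y p)
  from WhileFalse.prems show ?case
    by (rule exec_WhileE) (use WhileFalse.hyps in simp_all)
next
  case (WhileTrue s x y p t s1 v s2)
  from WhileTrue.prems show ?case
  proof (rule exec_WhileE)
    fix t' s' u' assume *: "u = Suc (t' + u')" "exec B p s t' s'" "exec B (WhileLess x y p) s' u' s''"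
    from WhileTrue.IH(1)[OF *(2)] WhileTrue.IH(2)[of u' s''] * show ?thesis by simp
  qed (use WhileTrue.hyps in blast)
qed (erule exec_elims; simp)+

text \<open>A tournament on \<open>{..<n}\<close> is given by \<open>n\<close> in register 0 and its adjacency matrix, stored row by
  row in memory cells \<open>0, \<dots>, n\<^sup>2 - 1\<close>.\<close>

definition input_state :: "nat \<Rightarrow> nat rel \<Rightarrow> ram_state" where
  "input_state n A =
     ((\<lambda>r. if r = 0 then n else 0),
      (\<lambda>a. if a < n * n \<and> (a div n, a mod n) \<in> A then 1 else 0))"

end

theory Submission
  imports Defs
begin

text \<open>
  Two inversions amount to labelling every vertex by a vector of \<open>\<bbbF>\<^sub>2\<^sup>2\<close> and reversing
  the arcs whose ends have dot product 1. Fix a labelling that makes the tournament transitive, and let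
  \<open>u\<close> and \<open>u'\<close> be the first and the last vertex with nonzero label in the resulting order. The vertices
  outside this range have label 0, and inside it the arcs of \<open>v\<close> with \<open>u\<close> and \<open>u'\<close> reveal the dot products
  of the label of \<open>v\<close> with those of \<open>u\<close> and \<open>u'\<close>. Two further vertices resolve what remains ambiguous, so
  that the label of \<open>v\<close> is a function of the adjacency of \<open>v\<close> to only four vertices (unless the tournament
  was transitive to begin with). It therefore suffices to try all quadruples of vertices together with
  each of the constantly many functions from adjacency types to labels.

  Transitivity of the resulting tournament is tested by two nested loops: the number \<open>C\<close> of cyclic
  ordered triples satisfies \<open>2 C + 3 \<Sum> deg\<^sup>2 = (2n - 1) \<Sum> deg\<close>, where \<open>deg\<close> is the outdegree and
  \<open>\<Sum> deg\<close> depends on \<open>n\<close> only, so the sum of the squared outdegrees is maximal exactly for transitive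
  tournaments. Altogether six nested loops suffice, without any use of the memory beyond the input.
\<close>

section \<open>Evaluating expressions with bounded sums on the machine\<close>

text \<open>Register 0 keeps the number of vertices. Variable registers hold the loop variables, in the order of
  nesting; temporary registers form the evaluation stack.\<close>

definition var_reg :: "nat \<Rightarrow> nat" where "var_reg i = 2 * i + 1"
definition tmp_reg :: "nat \<Rightarrow> nat" where "tmp_reg k = 2 * k + 2"

lemma reg_simps [simp]:
  "var_reg i \<noteq> 0" "tmp_reg k \<noteq> 0" "0 \<noteq> var_reg i" "0 \<noteq> tmp_reg k"
  "var_reg i \<noteq> tmp_reg k" "tmp_reg k \<noteq> var_reg i"
  "var_reg i = var_reg j \<longleftrightarrow> i = j" "tmp_reg k = tmp_reg l \<longleftrightarrow> k = l"
  unfolding var_reg_def tmp_reg_def by presburger+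

abbreviation adj_mem :: "nat \<Rightarrow> nat rel \<Rightarrow> nat \<Rightarrow> nat" where
  "adj_mem n A \<equiv> snd (input_state n A)"

text \<open>\<open>p\<close> evaluates an expression with \<open>d\<close> free variables, whose values are given by \<open>\<sigma>\<close>, into the
  temporary register \<open>k\<close> in at most \<open>T\<close> steps, and may overwrite only the registers of bound variables
  and the stack from \<open>k\<close> upwards.\<close>

definition computes :: "ram \<Rightarrow> nat \<Rightarrow> nat \<Rightarrow> nat \<Rightarrow> nat \<Rightarrow> nat rel \<Rightarrow> (nat \<Rightarrow> nat) \<Rightarrow> nat \<Rightarrow> nat \<Rightarrow> bool" where
  "computes p d k B n A \<sigma> x T \<longleftrightarrow>
     (\<forall>R. R 0 = n \<longrightarrow> (\<forall>i<d. R (var_reg i) = \<sigma> i) \<longrightarrow>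
       (\<exists>t R'. exec B p (R, adj_mem n A) t (R', adj_mem n A) \<and> t \<le> T \<and> R' (tmp_reg k) = x \<and>
         R' 0 = n \<and> (\<forall>i<d. R' (var_reg i) = \<sigma> i) \<and> (\<forall>j<k. R' (tmp_reg j) = R (tmp_reg j))))"

text \<open>The numbers \<open>b\<close>, \<open>c\<close> and the programs \<open>p k\<close> are
  chosen before \<open>n\<close> and \<open>A\<close>, so one program serves all inputs. The power
  of \<open>n + 2\<close> bounds the value and also suffices as word size for all intermediate
  results; the bases \<open>n + 2\<close> and \<open>n + 1\<close> keep the word and time bounds
  meaningful at \<open>n = 0\<close>.\<close>

definition computable :: "nat \<Rightarrow> nat \<Rightarrow> (nat \<Rightarrow> nat rel \<Rightarrow> (nat \<Rightarrow> nat) \<Rightarrow> nat) \<Rightarrow> bool" where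
  "computable d q F \<longleftrightarrow>
     (\<exists>b c p. \<forall>n A \<sigma>. (\<forall>i<d. \<sigma> i < n) \<longrightarrow>
       F n A \<sigma> < (n + 2) ^ b \<and>
       (\<forall>k B. (n + 2) ^ b \<le> B \<longrightarrow> computes (p k) d k B n A \<sigma> (F n A \<sigma>) (c * (n + 1) ^ q)))"

lemma computableI:
  assumes "\<And>n A \<sigma>. (\<And>i. i < d \<Longrightarrow> \<sigma> i < n) \<Longrightarrow> F n A \<sigma> < (n + 2) ^ b"
    and "\<And>n A \<sigma> k B. (\<And>i. i < d \<Longrightarrow> \<sigma> i < n) \<Longrightarrow> (n + 2) ^ b \<le> B \<Longrightarrow>
      computes (p k) d k B n A \<sigma> (F n A \<sigma>) (c * (n + 1) ^ q)"
  shows "computable d q F"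
  unfolding computable_def using assms by blast

lemma computableE:
  assumes "computable d q F"
  obtains b c p where
    "\<And>n A \<sigma>. (\<And>i. i < d \<Longrightarrow> \<sigma> i < n) \<Longrightarrow> F n A \<sigma> < (n + 2) ^ b"
    "\<And>n A \<sigma> k B. (\<And>i. i < d \<Longrightarrow> \<sigma> i < n) \<Longrightarrow> (n + 2) ^ b \<le> B \<Longrightarrow>
      computes (p k) d k B n A \<sigma> (F n A \<sigma>) (c * (n + 1) ^ q)"
  using assms unfolding computable_def by metis

lemma computesD:
  assumes "computes p d k B n A \<sigma> x T" "R 0 = n" "\<forall>i<d. R (var_reg i) = \<sigma> i"
  obtains t R' where "exec B p (R, adj_mem n A) t (R', adj_mem n A)" "t \<le> T" "R' (tmp_reg k) = x"
    "R' 0 = n" "\<forall>i<d. R' (var_reg i) = \<sigma> i" "\<forall>j<k. R' (tmp_reg j) = R (tmp_reg j)"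
  using assms unfolding computes_def by blast

lemma le_mult_power: "m \<le> c \<Longrightarrow> m \<le> c * (n + 1) ^ q" for m c n q :: nat
  by (metis One_nat_def Suc_eq_plus1 le_trans mult_le_mono2 mult.right_neutral one_le_power le_add2)

section \<open>Closure of computability under arithmetic, comparison and bounded sums\<close>

lemma computable_const: "computable d q (\<lambda>n A \<sigma>. x)"
proof (rule computableI[where b = x and c = 1 and p = "\<lambda>k. Const (tmp_reg k) x"])
  fix n A and \<sigma> :: "nat \<Rightarrow> nat" and k B
  have "x < 2 ^ x" by (rule less_exp)
  also have "\<dots> \<le> (n + 2) ^ x" by (rule power_mono) auto
  finally show x: "x < (n + 2) ^ x" .
  assume "(n + 2) ^ x \<le> B"
  with x have "x < B" by simp
  show "computes (Const (tmp_reg k) x) d k B n A \<sigma> x (1 * (n + 1) ^ q)"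
    unfolding computes_def
    using Const[OF \<open>x < B\<close>, of "tmp_reg k"]
    by (fastforce intro!: exI[of _ 1])
qed

text \<open>The machine has no move instruction, so the value is copied by adding it to a cleared
  register.\<close>

lemma computable_var:
  assumes "i < d"
  shows "computable d q (\<lambda>n A \<sigma>. \<sigma> i)"
proof (rule computableI[where b = 1 and c = 2 and
      p = "\<lambda>k. Seq (Const (tmp_reg k) 0) (Add (tmp_reg k) (tmp_reg k) (var_reg i))"])
  fix n A and \<sigma> :: "nat \<Rightarrow> nat" and k B
  assume \<sigma>: "\<And>i. i < d \<Longrightarrow> \<sigma> i < n"
  show "\<sigma> i < (n + 2) ^ 1" using \<sigma>[OF assms] by simp
  assume "(n + 2) ^ 1 \<le> B"
  hence B: "0 < B" "\<sigma> i < B" using \<sigma>[OF assms] by auto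
  show "computes (Seq (Const (tmp_reg k) 0) (Add (tmp_reg k) (tmp_reg k) (var_reg i)))
      d k B n A \<sigma> (\<sigma> i) (2 * (n + 1) ^ q)"
    unfolding computes_def
  proof (intro allI impI)
    fix R :: "nat \<Rightarrow> nat"
    assume R: "R 0 = n" "\<forall>i<d. R (var_reg i) = \<sigma> i"
    let ?R = "R(tmp_reg k := 0)"
    have "exec B (Seq (Const (tmp_reg k) 0) (Add (tmp_reg k) (tmp_reg k) (var_reg i)))
        (R, adj_mem n A) (1 + 1)
        (?R(tmp_reg k := ?R (tmp_reg k) + ?R (var_reg i)), adj_mem n A)"
      using R B assms by (intro exec.Seq[OF exec.Const exec.Add]) auto
    then show "\<exists>t R'. exec B (Seq (Const (tmp_reg k) 0) (Add (tmp_reg k) (tmp_reg k) (var_reg i)))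
        (R, adj_mem n A) t (R', adj_mem n A) \<and> t \<le> 2 * (n + 1) ^ q \<and>
        R' (tmp_reg k) = \<sigma> i \<and> R' 0 = n \<and> (\<forall>i<d. R' (var_reg i) = \<sigma> i) \<and>
        (\<forall>j<k. R' (tmp_reg j) = R (tmp_reg j))"
      by (intro exI conjI, assumption) (use R assms le_mult_power[of "Suc (Suc 0)" 2 n q] in auto)
  qed
qed

text \<open>The row-major address is built in the result register itself. Although the result is a
  single bit, the exponent is 2 because the address, which is below \<open>n * n\<close>, must fit
  into a word.\<close>

lemma computable_arc:
  assumes "i < d" "j < d"
  shows "computable d q (\<lambda>n A \<sigma>. of_bool ((\<sigma> i, \<sigma> j) \<in> A))"
proof (rule computableI[where b = 2 and c = 3 and
      p = "\<lambda>k. Seq (Mul (tmp_reg k) (var_reg i) 0)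
             (Seq (Add (tmp_reg k) (tmp_reg k) (var_reg j)) (Load (tmp_reg k) (tmp_reg k)))"])
  fix n A and \<sigma> :: "nat \<Rightarrow> nat" and k B
  assume "\<And>i. i < d \<Longrightarrow> \<sigma> i < n"
  hence \<sigma>: "\<sigma> i < n" "\<sigma> j < n" using assms by auto
  show "of_bool ((\<sigma> i, \<sigma> j) \<in> A) < (n + 2) ^ 2" by (simp add: power2_eq_square)
  let ?p = "Seq (Mul (tmp_reg k) (var_reg i) 0)
             (Seq (Add (tmp_reg k) (tmp_reg k) (var_reg j)) (Load (tmp_reg k) (tmp_reg k)))"
  have addr: "\<sigma> i * n + \<sigma> j < n * n"
  proof -
    have "Suc (\<sigma> i) * n \<le> n * n" using \<sigma> by (intro mult_le_mono1) simp
    thus ?thesis using \<sigma> by simp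
  qed
  assume B: "(n + 2) ^ 2 \<le> B"
  have "n * n \<le> (n + 2) ^ 2" by (simp add: power2_eq_square)
  with addr B have addr_B: "\<sigma> i * n + \<sigma> j < B" by linarith
  show "computes ?p d k B n A \<sigma> (of_bool ((\<sigma> i, \<sigma> j) \<in> A)) (3 * (n + 1) ^ q)"
    unfolding computes_def
  proof (intro allI impI)
    fix R :: "nat \<Rightarrow> nat"
    assume R: "R 0 = n" "\<forall>i<d. R (var_reg i) = \<sigma> i"
    let ?M = "adj_mem n A"
    let ?R1 = "R(tmp_reg k := R (var_reg i) * R 0)"
    let ?R2 = "?R1(tmp_reg k := ?R1 (tmp_reg k) + ?R1 (var_reg j))"
    have "exec B ?p (R, ?M) (1 + (1 + 1)) (?R2(tmp_reg k := ?M (?R2 (tmp_reg k))), ?M)"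
      using R addr_B assms by (intro exec.Seq[OF exec.Mul exec.Seq[OF exec.Add exec.Load]]) auto
    moreover have "?M (\<sigma> i * n + \<sigma> j) = of_bool ((\<sigma> i, \<sigma> j) \<in> A)"
      using addr \<sigma> by (simp add: input_state_def)
    ultimately show "\<exists>t R'. exec B ?p (R, ?M) t (R', ?M) \<and> t \<le> 3 * (n + 1) ^ q \<and>
        R' (tmp_reg k) = of_bool ((\<sigma> i, \<sigma> j) \<in> A) \<and> R' 0 = n \<and>
        (\<forall>i<d. R' (var_reg i) = \<sigma> i) \<and> (\<forall>j<k. R' (tmp_reg j) = R (tmp_reg j))"
      by - (intro exI conjI, assumption, use R assms le_mult_power[of "Suc (Suc (Suc 0))" 3 n q] in auto)
  qed
qed

text \<open>The second operand is evaluated one stack cell higher, which leaves the first one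
  intact. The exponent \<open>b + b'\<close> would be enough for products; the extra factor
  \<open>n + 2\<close> absorbs the 2 of a sum. Two steps are granted to the operation because a
  comparison is a test followed by an assignment.\<close>

lemma computable_binop:
  assumes F: "computable d q F" and G: "computable d q G"
    and bound: "\<And>b b' n x y. x < (n + 2) ^ b \<Longrightarrow> y < (n + 2) ^ b' \<Longrightarrow> h x y < (n + 2) ^ Suc (b + b')"
    and exec_op: "\<And>B k R M. 2 \<le> B \<Longrightarrow> h (R (tmp_reg k)) (R (tmp_reg (Suc k))) < B \<Longrightarrow>
      \<exists>t\<le>2. exec B (op k) (R, M) t (R(tmp_reg k := h (R (tmp_reg k)) (R (tmp_reg (Suc k)))), M)"
  shows "computable d q (\<lambda>n A \<sigma>. h (F n A \<sigma>) (G n A \<sigma>))"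
proof -
  obtain b c p where bF: "\<And>n A \<sigma>. (\<And>i. i < d \<Longrightarrow> \<sigma> i < n) \<Longrightarrow> F n A \<sigma> < (n + 2) ^ b"
    and pF: "\<And>n A \<sigma> k B. (\<And>i. i < d \<Longrightarrow> \<sigma> i < n) \<Longrightarrow> (n + 2) ^ b \<le> B \<Longrightarrow>
      computes (p k) d k B n A \<sigma> (F n A \<sigma>) (c * (n + 1) ^ q)"
    by (rule computableE[OF F]) blast
  obtain b' c' p' where bG: "\<And>n A \<sigma>. (\<And>i. i < d \<Longrightarrow> \<sigma> i < n) \<Longrightarrow> G n A \<sigma> < (n + 2) ^ b'"
    and pG: "\<And>n A \<sigma> k B. (\<And>i. i < d \<Longrightarrow> \<sigma> i < n) \<Longrightarrow> (n + 2) ^ b' \<le> B \<Longrightarrow>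
      computes (p' k) d k B n A \<sigma> (G n A \<sigma>) (c' * (n + 1) ^ q)"
    by (rule computableE[OF G]) blast
  show ?thesis
  proof (rule computableI[where b = "Suc (b + b')" and c = "c + c' + 2" and
        p = "\<lambda>k. Seq (p k) (Seq (p' (Suc k)) (op k))"])
    fix n A and \<sigma> :: "nat \<Rightarrow> nat" and k B
    assume \<sigma>: "\<And>i. i < d \<Longrightarrow> \<sigma> i < n"
    let ?F = "F n A \<sigma>" and ?G = "G n A \<sigma>" and ?M = "adj_mem n A"
    show h: "h ?F ?G < (n + 2) ^ Suc (b + b')"
      using \<sigma> by (intro bound bF bG)
    assume B: "(n + 2) ^ Suc (b + b') \<le> B"
    have le: "(n + 2) ^ i \<le> B" if "i \<le> Suc (b + b')" for i
      using power_increasing[OF that, of "n + 2"] B by simp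
    have "2 \<le> B" using le[of 1] by simp
    show "computes (Seq (p k) (Seq (p' (Suc k)) (op k))) d k B n A \<sigma> (h ?F ?G)
        ((c + c' + 2) * (n + 1) ^ q)"
      unfolding computes_def
    proof (intro allI impI)
      fix R :: "nat \<Rightarrow> nat"
      assume R: "R 0 = n" "\<forall>i<d. R (var_reg i) = \<sigma> i"
      obtain t1 R1 where 1: "exec B (p k) (R, ?M) t1 (R1, ?M)" "t1 \<le> c * (n + 1) ^ q"
        "R1 (tmp_reg k) = ?F" "R1 0 = n" "\<forall>i<d. R1 (var_reg i) = \<sigma> i"
        "\<forall>j<k. R1 (tmp_reg j) = R (tmp_reg j)"
        by (rule computesD[OF pF[OF \<sigma> le] R, of k A]) auto
      obtain t2 R2 where 2: "exec B (p' (Suc k)) (R1, ?M) t2 (R2, ?M)" "t2 \<le> c' * (n + 1) ^ q"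
        "R2 (tmp_reg (Suc k)) = ?G" "R2 0 = n" "\<forall>i<d. R2 (var_reg i) = \<sigma> i"
        "\<forall>j<Suc k. R2 (tmp_reg j) = R1 (tmp_reg j)"
        by (rule computesD[OF pG[OF \<sigma> le] 1(4,5), of "Suc k" A]) auto
      have "R2 (tmp_reg k) = ?F" using 1 2 by simp
      with 2 exec_op[OF \<open>2 \<le> B\<close>, of R2 k ?M] h B obtain t3 where
        3: "t3 \<le> 2" "exec B (op k) (R2, ?M) t3 (R2(tmp_reg k := h ?F ?G), ?M)" by auto
      have "exec B (Seq (p k) (Seq (p' (Suc k)) (op k))) (R, ?M) (t1 + (t2 + t3))
          (R2(tmp_reg k := h ?F ?G), ?M)"
        using 1 2 3 by (blast intro: exec.Seq)
      moreover have "t1 + (t2 + t3) \<le> (c + c' + 2) * (n + 1) ^ q"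
        using 1(2) 2(2) le_mult_power[OF 3(1), of n q] by (simp add: add_mult_distrib)
      ultimately show "\<exists>t R'. exec B (Seq (p k) (Seq (p' (Suc k)) (op k))) (R, ?M) t (R', ?M) \<and>
          t \<le> (c + c' + 2) * (n + 1) ^ q \<and> R' (tmp_reg k) = h ?F ?G \<and> R' 0 = n \<and>
          (\<forall>i<d. R' (var_reg i) = \<sigma> i) \<and> (\<forall>j<k. R' (tmp_reg j) = R (tmp_reg j))"
        by - (intro exI conjI, assumption, use 1 2 in auto)
    qed
  qed
qed

lemma computable_add:
  assumes "computable d q F" "computable d q G"
  shows "computable d q (\<lambda>n A \<sigma>. F n A \<sigma> + G n A \<sigma>)"
proof (rule computable_binop[OF assms, where op = "\<lambda>k. Add (tmp_reg k) (tmp_reg k) (tmp_reg (Suc k))"])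
  fix b b' n x y :: nat
  assume "x < (n + 2) ^ b" "y < (n + 2) ^ b'"
  moreover have "(n + 2) ^ b \<le> (n + 2) ^ (b + b')" "(n + 2) ^ b' \<le> (n + 2) ^ (b + b')"
    by (intro power_increasing; simp)+
  ultimately have "x + y < 2 * (n + 2) ^ (b + b')" by linarith
  also have "\<dots> \<le> (n + 2) * (n + 2) ^ (b + b')" by (rule mult_le_mono1) simp
  finally show "x + y < (n + 2) ^ Suc (b + b')" by simp
qed (use exec.Add in \<open>fastforce intro!: exI[of _ 1]\<close>)

lemma computable_mult:
  assumes "computable d q F" "computable d q G"
  shows "computable d q (\<lambda>n A \<sigma>. F n A \<sigma> * G n A \<sigma>)"
proof (rule computable_binop[OF assms, where op = "\<lambda>k. Mul (tmp_reg k) (tmp_reg k) (tmp_reg (Suc k))"])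
  fix b b' n x y :: nat
  assume "x < (n + 2) ^ b" "y < (n + 2) ^ b'"
  hence "x * y < (n + 2) ^ b * (n + 2) ^ b'"
    by (intro mult_strict_mono') auto
  also have "\<dots> = (n + 2) ^ (b + b')" by (rule power_add[symmetric])
  also have "\<dots> \<le> (n + 2) ^ Suc (b + b')" by (intro power_increasing) auto
  finally show "x * y < (n + 2) ^ Suc (b + b')" .
qed (use exec.Mul in \<open>fastforce intro!: exI[of _ 1]\<close>)

lemma computable_less:
  assumes "computable d q F" "computable d q G"
  shows "computable d q (\<lambda>n A \<sigma>. of_bool (F n A \<sigma> < G n A \<sigma>))"
proof (rule computable_binop[OF assms, where h = "\<lambda>x y. of_bool (x < y)" and
      op = "\<lambda>k. IfLess (tmp_reg k) (tmp_reg (Suc k)) (Const (tmp_reg k) 1) (Const (tmp_reg k) 0)"])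
  fix b b' n x y :: nat
  have "1 < (n + 2) ^ Suc (b + b')" by (rule one_less_power) auto
  thus "of_bool (x < y) < (n + 2) ^ Suc (b + b')" by (simp add: of_bool_def del: power_Suc)
next
  fix B k :: nat and R M :: "nat \<Rightarrow> nat"
  assume "2 \<le> B"
  let ?p = "IfLess (tmp_reg k) (tmp_reg (Suc k)) (Const (tmp_reg k) 1) (Const (tmp_reg k) 0)"
  have "exec B ?p (R, M) (1 + 1) (R(tmp_reg k := of_bool (R (tmp_reg k) < R (tmp_reg (Suc k)))), M)"
  proof (cases "R (tmp_reg k) < R (tmp_reg (Suc k))")
    case True
    with \<open>2 \<le> B\<close> show ?thesis by (simp only: of_bool_eq) (intro exec.IfTrue exec.Const; simp)
  next
    case False
    with \<open>2 \<le> B\<close> show ?thesis by (simp only: of_bool_eq) (intro exec.IfFalse exec.Const; simp)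
  qed
  thus "\<exists>t\<le>2. exec B ?p (R, M) t (R(tmp_reg k := of_bool (R (tmp_reg k) < R (tmp_reg (Suc k)))), M)"
    by (intro exI[of _ "1 + 1"]) simp
qed

text \<open>The stack cell \<open>k\<close> accumulates, \<open>var_reg d\<close> counts, and each
  summand is evaluated in cell \<open>Suc k\<close>, which is then reused for the constant 1 that
  increments the counter. The \<open>n\<close> rounds raise the exponent of the running time by
  one.\<close>

lemma computable_sum_vertices:
  assumes F: "computable (Suc d) q F"
  shows "computable d (Suc q) (\<lambda>n A \<sigma>. \<Sum>x<n. F n A (\<sigma>(d := x)))"
proof -
  obtain b c p where bF: "\<And>n A \<sigma>. (\<And>i. i < Suc d \<Longrightarrow> \<sigma> i < n) \<Longrightarrow> F n A \<sigma> < (n + 2) ^ b"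
    and pF: "\<And>n A \<sigma> k B. (\<And>i. i < Suc d \<Longrightarrow> \<sigma> i < n) \<Longrightarrow> (n + 2) ^ b \<le> B \<Longrightarrow>
      computes (p k) (Suc d) k B n A \<sigma> (F n A \<sigma>) (c * (n + 1) ^ q)"
    by (rule computableE[OF F]) blast
  define body where "body k = Seq (p (Suc k)) (Seq (Add (tmp_reg k) (tmp_reg k) (tmp_reg (Suc k)))
    (Seq (Const (tmp_reg (Suc k)) 1) (Add (var_reg d) (var_reg d) (tmp_reg (Suc k)))))" for k
  define loop where "loop k = WhileLess (var_reg d) 0 (body k)" for k
  show ?thesis
  proof (rule computableI[where b = "Suc b" and c = "c + 7" and
        p = "\<lambda>k. Seq (Const (tmp_reg k) 0) (Seq (Const (var_reg d) 0) (loop k))"])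
    fix n A and \<sigma> :: "nat \<Rightarrow> nat" and k B
    assume \<sigma>: "\<And>i. i < d \<Longrightarrow> \<sigma> i < n"
    let ?F = "\<lambda>x. F n A (\<sigma>(d := x))" and ?M = "adj_mem n A"
    have \<sigma>': "\<And>i. i < Suc d \<Longrightarrow> (\<sigma>(d := x)) i < n" if "x < n" for x
      using \<sigma> that by (auto simp: less_Suc_eq)
    have sum_less: "(\<Sum>x<m. ?F x) < (n + 2) ^ Suc b" if "m \<le> n" for m
    proof -
      have "(\<Sum>x<m. ?F x) \<le> (\<Sum>x<m. (n + 2) ^ b)"
        using that by (intro sum_mono less_imp_le bF \<sigma>') auto
      also have "\<dots> < (n + 2) * (n + 2) ^ b"
        using that mult_strict_right_mono[of m "n + 2" "(n + 2) ^ b"] by simp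
      finally show ?thesis by simp
    qed
    then show "(\<Sum>x<n. ?F x) < (n + 2) ^ Suc b" by blast
    assume B: "(n + 2) ^ Suc b \<le> B"
    have "n + 2 \<le> (n + 2) ^ Suc b" by (rule self_le_power) auto
    with B have nB: "n + 2 \<le> B" by linarith
    have "(n + 2) ^ b \<le> (n + 2) ^ Suc b" by simp
    with B have bB: "(n + 2) ^ b \<le> B" by linarith
    \<comment> \<open>The 4 pays for the three instructions after the summand and for the loop test;
      hence the body alone stays strictly below \<open>T\<close>.\<close>
    define T where "T = c * (n + 1) ^ q + 4"
    have body: "\<exists>t R'. exec B (body k) (R, ?M) t (R', ?M) \<and> t < T \<and>
        R' (tmp_reg k) = (\<Sum>x<Suc m. ?F x) \<and> R' 0 = n \<and> (\<forall>i<d. R' (var_reg i) = \<sigma> i) \<and>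
        R' (var_reg d) = Suc m \<and> (\<forall>j<k. R' (tmp_reg j) = R (tmp_reg j))"
      if R: "R 0 = n" "\<forall>i<d. R (var_reg i) = \<sigma> i" "R (var_reg d) = m" "m < n"
        "R (tmp_reg k) = (\<Sum>x<m. ?F x)" for R m
    proof -
      have Rd: "\<forall>i<Suc d. R (var_reg i) = (\<sigma>(d := m)) i" using R by (auto simp: less_Suc_eq)
      obtain t R1 where 1: "exec B (p (Suc k)) (R, ?M) t (R1, ?M)" "t \<le> c * (n + 1) ^ q"
        "R1 (tmp_reg (Suc k)) = ?F m" "R1 0 = n" "\<forall>i<Suc d. R1 (var_reg i) = (\<sigma>(d := m)) i"
        "\<forall>j<Suc k. R1 (tmp_reg j) = R (tmp_reg j)"
        using computesD[OF pF[where k = "Suc k" and A = A, OF \<sigma>'[OF \<open>m < n\<close>] bB] R(1) Rd] by blast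
      have add: "R1 (tmp_reg k) + R1 (tmp_reg (Suc k)) = (\<Sum>x<Suc m. ?F x)"
        using 1 R by simp
      let ?R2 = "R1(tmp_reg k := R1 (tmp_reg k) + R1 (tmp_reg (Suc k)))"
      let ?R3 = "?R2(tmp_reg (Suc k) := 1)"
      let ?R4 = "?R3(var_reg d := ?R3 (var_reg d) + ?R3 (tmp_reg (Suc k)))"
      have d: "R1 (var_reg d) = m" using 1 by simp
      have "R1 (tmp_reg k) + R1 (tmp_reg (Suc k)) < B"
        unfolding add using sum_less[of "Suc m"] B R by simp
      moreover have "1 < B" using nB by simp
      moreover have "?R3 (var_reg d) + ?R3 (tmp_reg (Suc k)) < B" using d nB R by simp
      ultimately have "exec B (body k) (R, ?M) (t + (1 + (1 + 1))) (?R4, ?M)"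
        unfolding body_def by (intro exec.Seq[OF 1(1) exec.Seq[OF exec.Add exec.Seq[OF exec.Const exec.Add]]])
      moreover have "?R4 (tmp_reg k) = (\<Sum>x<Suc m. ?F x)" using add by simp
      moreover have "?R4 (var_reg d) = Suc m" using d by simp
      moreover have "t + (1 + (1 + 1)) < T" using 1(2) unfolding T_def by simp
      moreover have "?R4 0 = n" "\<forall>i<d. ?R4 (var_reg i) = \<sigma> i" "\<forall>j<k. ?R4 (tmp_reg j) = R (tmp_reg j)"
        using 1 by auto
      ultimately show ?thesis by blast
    qed
    have loop: "\<exists>t R'. exec B (loop k) (R, ?M) t (R', ?M) \<and> t \<le> (n - m) * T + 1 \<and>
        R' (tmp_reg k) = (\<Sum>x<n. ?F x) \<and> R' 0 = n \<and> (\<forall>i<d. R' (var_reg i) = \<sigma> i) \<and>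
        (\<forall>j<k. R' (tmp_reg j) = R (tmp_reg j))"
      if "R 0 = n" "\<forall>i<d. R (var_reg i) = \<sigma> i" "R (var_reg d) = m" "m \<le> n"
        "R (tmp_reg k) = (\<Sum>x<m. ?F x)" for R m
      using that(4) that(1-3,5)
    \<comment> \<open>Here \<open>m\<close> counts the completed rounds, and the induction runs
      downwards from \<open>n\<close>. The additional step in the bound is the final failing
      test.\<close>
    proof (induction m arbitrary: R rule: inc_induct)
      case base
      have "exec B (loop k) (R, ?M) 1 (R, ?M)"
        unfolding loop_def by (rule exec.WhileFalse) (simp add: base)
      with base show ?case by (intro exI[of _ 1] exI[of _ R]) auto
    next
      case (step m)
      obtain t1 R1 where 1: "exec B (body k) (R, ?M) t1 (R1, ?M)" "t1 < T"
        "R1 (tmp_reg k) = (\<Sum>x<Suc m. ?F x)" "R1 0 = n" "\<forall>i<d. R1 (var_reg i) = \<sigma> i"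
        "R1 (var_reg d) = Suc m" "\<forall>j<k. R1 (tmp_reg j) = R (tmp_reg j)"
        using body[OF step.prems(1-3) \<open>m < n\<close> step.prems(4)] by blast
      obtain t2 R2 where 2: "exec B (loop k) (R1, ?M) t2 (R2, ?M)" "t2 \<le> (n - Suc m) * T + 1"
        "R2 (tmp_reg k) = (\<Sum>x<n. ?F x)" "R2 0 = n" "\<forall>i<d. R2 (var_reg i) = \<sigma> i"
        "\<forall>j<k. R2 (tmp_reg j) = R1 (tmp_reg j)"
        using step.IH[OF 1(4,5,6,3)] by blast
      have "exec B (loop k) (R, ?M) (1 + t1 + t2) (R2, ?M)"
        unfolding loop_def
        by (rule exec.WhileTrue[OF _ 1(1) 2(1)[unfolded loop_def]]) (use step in simp)
      moreover have "1 + t1 + t2 \<le> (n - m) * T + 1"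
      proof -
        have "(n - m) * T = T + (n - Suc m) * T"
          using \<open>m < n\<close> by (metis Suc_diff_Suc mult_Suc)
        thus ?thesis using 1(2) 2(2) by linarith
      qed
      ultimately show ?case using 1 2 by (metis (no_types, lifting))
    qed
    show "computes (Seq (Const (tmp_reg k) 0) (Seq (Const (var_reg d) 0) (loop k))) d k B n A \<sigma>
        (\<Sum>x<n. ?F x) ((c + 7) * (n + 1) ^ Suc q)"
      unfolding computes_def
    proof (intro allI impI)
      fix R :: "nat \<Rightarrow> nat"
      assume R: "R 0 = n" "\<forall>i<d. R (var_reg i) = \<sigma> i"
      let ?R = "R(tmp_reg k := 0, var_reg d := 0)"
      obtain t R' where 1: "exec B (loop k) (?R, ?M) t (R', ?M)" "t \<le> (n - 0) * T + 1"
        "R' (tmp_reg k) = (\<Sum>x<n. ?F x)" "R' 0 = n" "\<forall>i<d. R' (var_reg i) = \<sigma> i"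
        "\<forall>j<k. R' (tmp_reg j) = ?R (tmp_reg j)"
        using loop[of ?R 0] R by auto
      have "exec B (Seq (Const (tmp_reg k) 0) (Seq (Const (var_reg d) 0) (loop k)))
          (R, ?M) (1 + (1 + t)) (R', ?M)"
        using nB by (intro exec.Seq[OF exec.Const exec.Seq[OF exec.Const 1(1)]]) auto
      moreover have "1 + (1 + t) \<le> (c + 7) * (n + 1) ^ Suc q"
      proof -
        let ?N = "(n + 1) ^ q"
        have "1 \<le> ?N" by simp
        hence "T \<le> (c + 4) * ?N" unfolding T_def add_mult_distrib by simp
        moreover have "3 \<le> 3 * ((n + 1) * ?N)" using le_mult_power[of 3 3 n "Suc q"] by simp
        ultimately have "n * T + 3 \<le> (n + 1) * ((c + 4) * ?N) + 3 * ((n + 1) * ?N)"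
          by (intro add_mono mult_mono) auto
        also have "\<dots> = (c + 7) * (n + 1) ^ Suc q" by (simp add: algebra_simps)
        finally show ?thesis using 1(2) by simp
      qed
      ultimately show "\<exists>t R'. exec B (Seq (Const (tmp_reg k) 0) (Seq (Const (var_reg d) 0) (loop k)))
          (R, ?M) t (R', ?M) \<and> t \<le> (c + 7) * (n + 1) ^ Suc q \<and> R' (tmp_reg k) = (\<Sum>x<n. ?F x) \<and>
          R' 0 = n \<and> (\<forall>i<d. R' (var_reg i) = \<sigma> i) \<and> (\<forall>j<k. R' (tmp_reg j) = R (tmp_reg j))"
        by - (intro exI conjI, assumption, use 1 in auto)
    qed
  qed
qed

section \<open>Inversions as labellings\<close>

text \<open>The inequality of truth values acts as addition modulo 2.\<close>

definition label_dot :: "bool \<times> bool \<Rightarrow> bool \<times> bool \<Rightarrow> bool" where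
  "label_dot a b \<longleftrightarrow> (fst a \<and> fst b) \<noteq> (snd a \<and> snd b)"

definition flip :: "'a rel \<Rightarrow> ('a \<Rightarrow> bool \<times> bool) \<Rightarrow> 'a \<Rightarrow> 'a \<Rightarrow> bool" where
  "flip A l x y \<longleftrightarrow> (if label_dot (l x) (l y) then (y, x) \<in> A else (x, y) \<in> A)"

lemma mem_invert_iff: "(x, y) \<in> invert A X \<longleftrightarrow> (if x \<in> X \<and> y \<in> X then (y, x) \<in> A else (x, y) \<in> A)"
  by (auto simp: invert_def)

text \<open>An arc with both ends in both sets is reversed twice and thus keeps its direction, which
  is what the sum modulo 2 in \<open>label_dot\<close> expresses.\<close>

lemma invert_twice_eq_flip:
  "invert (invert A {x. fst (l x)}) {x. snd (l x)} = {(x, y). flip A l x y}"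
  by (rule set_eqI) (auto simp: mem_invert_iff flip_def label_dot_def split: if_splits)

lemma invert_restrict:
  assumes "A \<subseteq> V \<times> V"
  shows "invert A (X \<inter> V) = invert A X" "invert A X \<subseteq> V \<times> V"
  using assms by (auto simp: invert_def)

text \<open>Inverting the two ends of an arc that runs against the usual order of numbers removes
  that arc from the backward ones and creates no other. This makes the minimum in
  \<open>inv_number\<close> meaningful.\<close>

lemma ex_inversions_acyclic:
  fixes A :: "nat rel"
  assumes "finite A" "asym A" "A \<subseteq> V \<times> V"
  shows "\<exists>Xs. (\<forall>X\<in>set Xs. X \<subseteq> V) \<and> acyclic (foldl invert A Xs)"
  using assms
proof (induction "card {(x, y) \<in> A. y < x}" arbitrary: A rule: less_induct)
  case less
  show ?case
  proof (cases "{(x, y) \<in> A. y < x} = {}")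
    case True
    with less.prems have "A \<subseteq> less_than"
      by (auto simp: asym_iff) (metis linorder_neqE_nat)
    hence "acyclic A" using acyclic_subset wf_acyclic wf_less_than by blast
    thus ?thesis by (intro exI[of _ "[]"]) simp
  next
    case False
    then obtain x y where xy: "(x, y) \<in> A" "y < x" by blast
    let ?A = "invert A {x, y}"
    have sub: "?A \<subseteq> A \<union> A\<inverse>" by (auto simp: invert_def)
    have "(x, y) \<notin> ?A" using xy less.prems(2) by (simp add: mem_invert_iff asym_iff)
    moreover have "(v, w) \<in> A" if "(v, w) \<in> ?A" "w < v" for v w
      using that xy by (cases "(v, w) = (x, y)") (auto simp: mem_invert_iff split: if_splits)
    ultimately have "{(x, y) \<in> ?A. y < x} \<subset> {(x, y) \<in> A. y < x}"
      using xy by blast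
    moreover have "finite {(x, y) \<in> A. y < x}"
      by (rule finite_subset[OF _ less.prems(1)]) auto
    ultimately have "card {(x, y) \<in> ?A. y < x} < card {(x, y) \<in> A. y < x}"
      by (rule psubset_card_mono[rotated])
    moreover have "finite ?A" by (rule finite_subset[OF sub]) (simp add: less.prems(1))
    moreover have "asym ?A" using less.prems(2) by (auto simp: asym_iff mem_invert_iff)
    moreover have "?A \<subseteq> V \<times> V" by (rule invert_restrict(2)[OF less.prems(3)])
    ultimately obtain Xs where "\<forall>X\<in>set Xs. X \<subseteq> V" "acyclic (foldl invert ?A Xs)"
      using less.hyps by blast
    thus ?thesis using xy less.prems(3) by (intro exI[of _ "{x, y} # Xs"]) auto
  qed
qed

text \<open>Inverting the empty set changes nothing, so a shorter list of inversions can be padded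
  to length exactly 2, and a pair of sets is the same as a labelling.\<close>

lemma inv_number_le_2_iff:
  fixes A :: "nat rel"
  assumes "tournament V A"
  shows "inv_number V A \<le> 2 \<longleftrightarrow> (\<exists>l. acyclic {(x, y). flip A l x y})"
proof -
  have A: "A \<subseteq> V \<times> V" and fin: "finite A" "asym A"
    using assms finite_subset[of A "V \<times> V"] by (auto simp: tournament_def)
  define P where "P k \<longleftrightarrow> (\<exists>Xs. length Xs = k \<and> (\<forall>X\<in>set Xs. X \<subseteq> V) \<and> acyclic (foldl invert A Xs))" for k
  have inv: "inv_number V A = (LEAST k. P k)" unfolding inv_number_def P_def ..
  have P_Suc: "P (Suc k)" if "P k" for k
  proof -
    obtain Xs where "length Xs = k" "\<forall>X\<in>set Xs. X \<subseteq> V" "acyclic (foldl invert A Xs)"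
      using \<open>P k\<close> unfolding P_def by blast
    moreover have "invert A {} = A" by (simp add: invert_def)
    ultimately show ?thesis unfolding P_def by (intro exI[of _ "{} # Xs"]) simp
  qed
  have P_mono: "P m" if "P k" "k \<le> m" for k m
    using that(2,1) by (induction m rule: dec_induct) (auto intro: P_Suc)
  have ex: "\<exists>k. P k" using ex_inversions_acyclic[OF fin A] unfolding P_def by blast
  have "inv_number V A \<le> 2 \<longleftrightarrow> P 2"
    unfolding inv by (metis ex LeastI_ex Least_le P_mono)
  also have "\<dots> \<longleftrightarrow> (\<exists>l. acyclic {(x, y). flip A l x y})"
  proof
    assume "P 2"
    then obtain X Y where "acyclic (invert (invert A X) Y)"
      unfolding P_def by (auto simp: length_Suc_conv numeral_2_eq_2)
    moreover have "invert (invert A X) Y = {(x, y). flip A (\<lambda>x. (x \<in> X, x \<in> Y)) x y}"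
      unfolding invert_twice_eq_flip[symmetric] by simp
    ultimately show "\<exists>l. acyclic {(x, y). flip A l x y}" by metis
  next
    assume "\<exists>l. acyclic {(x, y). flip A l x y}"
    then obtain l where "acyclic (invert (invert A {x. fst (l x)}) {x. snd (l x)})"
      unfolding invert_twice_eq_flip by blast
    \<comment> \<open>A labelling may be nonzero outside \<open>V\<close>, whereas inverted sets
      must lie in \<open>V\<close>; cutting them down does not affect any arc.\<close>
    hence "acyclic (invert (invert A ({x. fst (l x)} \<inter> V)) ({x. snd (l x)} \<inter> V))"
      using A by (simp add: invert_restrict)
    thus "P 2" unfolding P_def
      by (intro exI[of _ "[{x. fst (l x)} \<inter> V, {x. snd (l x)} \<inter> V]"]) simp
  qed
  finally show ?thesis .
qed

section \<open>Recognising transitive tournaments by their outdegrees\<close>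

definition tour_on :: "nat \<Rightarrow> (nat \<Rightarrow> nat \<Rightarrow> bool) \<Rightarrow> bool" where
  "tour_on n e \<longleftrightarrow> (\<forall>x y. e x y \<longrightarrow> x < n \<and> y < n \<and> \<not> e y x) \<and> (\<forall>x<n. \<forall>y<n. x \<noteq> y \<longrightarrow> e x y \<or> e y x)"

definition outdeg :: "nat \<Rightarrow> (nat \<Rightarrow> nat \<Rightarrow> bool) \<Rightarrow> nat \<Rightarrow> nat" where
  "outdeg n e x = (\<Sum>y<n. of_bool (e x y))"

lemma tour_on_flip: "tournament {..<n} A \<Longrightarrow> tour_on n (flip A l)"
  unfolding tour_on_def tournament_def flip_def total_on_def asym_iff label_dot_def
  by (auto split: if_splits)

text \<open>Double counting. Pairs of outneighbours of a common vertex give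
  \<open>Q = 2 * S + m\<close>, where \<open>S\<close> counts transitive triples and
  \<open>m\<close> arcs. Walks of two arcs number \<open>(int n - 1) * m - Q\<close>, and each
  closes to a transitive or a cyclic triple, so this is \<open>S + C\<close>. Eliminating
  \<open>S\<close> yields the identity.\<close>

lemma three_cycle_count:
  assumes "tour_on n e"
  shows "2 * (\<Sum>x<n. \<Sum>y<n. \<Sum>z<n. of_bool (e x y \<and> e y z \<and> e z x)) + 3 * (\<Sum>x<n. int ((outdeg n e x)\<^sup>2))
    = (2 * int n - 1) * (\<Sum>x<n. int (outdeg n e x))"
    and "2 * (\<Sum>x<n. int (outdeg n e x)) = int n * (int n - 1)"
proof -
  define a where "a x y = (of_bool (e x y) :: int)" for x y
  define d where "d x = (\<Sum>y<n. a x y)" for x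
  define \<delta> where "\<delta> x y = (of_bool (x = y) :: int)" for x y :: nat
  define m where "m = (\<Sum>x<n. d x)"
  have d: "int (outdeg n e x) = d x" for x
    by (simp add: outdeg_def d_def a_def)
  have tot: "a x y + a y x + \<delta> x y = 1" if "x < n" "y < n" for x y
    using assms that unfolding tour_on_def a_def \<delta>_def by (cases "x = y") auto
  have delta: "(\<Sum>y<n. \<delta> x y * f y) = f x" if "x < n" for x and f :: "nat \<Rightarrow> int"
  proof -
    have "(\<Sum>y<n. \<delta> x y * f y) = (\<Sum>y<n. if x = y then f y else 0)"
      unfolding \<delta>_def by (intro sum.cong) auto
    also have "\<dots> = f x" using that by simp
    finally show ?thesis .
  qed
  have diag: "a x x = 0" for x using assms unfolding tour_on_def a_def by auto
  have sq: "a x y * a x y = a x y" for x y unfolding a_def by simp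
  have anti: "a x y * a y x = 0" for x y using assms unfolding tour_on_def a_def by auto
  have "int n * int n = (\<Sum>x<n. \<Sum>y<n. a x y + a y x + \<delta> x y)" using tot by simp
  also have "\<dots> = (\<Sum>x<n. \<Sum>y<n. a x y) + (\<Sum>x<n. \<Sum>y<n. a y x) + (\<Sum>x<n. \<Sum>y<n. \<delta> x y * 1)"
    by (simp add: sum.distrib)
  also have "(\<Sum>x<n. \<Sum>y<n. \<delta> x y * 1) = (\<Sum>x<n. 1)"
    by (intro sum.cong delta) auto
  also have "(\<Sum>x<n. \<Sum>y<n. a y x) = m"
    unfolding m_def d_def by (rule sum.swap)
  finally have m: "2 * m = int n * int n - int n"
    unfolding m_def d_def by simp
  define Q where "Q = (\<Sum>x<n. d x * d x)"
  define C where "C = (\<Sum>x<n. \<Sum>y<n. \<Sum>z<n. a x y * a y z * a z x)"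
  define S where "S = (\<Sum>x<n. \<Sum>y<n. \<Sum>z<n. a x y * a y z * a x z)"
  have ind: "(\<Sum>y<n. a y x) = int n - 1 - d x" if "x < n" for x
  proof -
    have "(\<Sum>y<n. a x y + a y x + \<delta> x y * 1) = int n" using tot that by simp
    thus ?thesis using delta[OF that, of "\<lambda>_. 1"] by (simp add: sum.distrib d_def)
  qed
  have "Q = (\<Sum>x<n. \<Sum>y<n. \<Sum>z<n. a x y * a x z)"
    unfolding Q_def d_def by (simp add: sum_product)
  \<comment> \<open>The inserted factor is 1 by \<open>tot\<close>; expanding it sorts the pairs by
    the arc between \<open>y\<close> and \<open>z\<close> or by their equality.\<close>
  also have "\<dots> = (\<Sum>x<n. \<Sum>y<n. \<Sum>z<n. a x y * a x z * (a y z + a z y + \<delta> y z))"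
    using tot by simp
  also have "\<dots> = S + (\<Sum>x<n. \<Sum>y<n. \<Sum>z<n. a x z * a z y * a x y) +
      (\<Sum>x<n. \<Sum>y<n. \<Sum>z<n. \<delta> y z * (a x y * a x z))"
    unfolding S_def by (simp add: algebra_simps sum.distrib)
  also have "(\<Sum>x<n. \<Sum>y<n. \<Sum>z<n. a x z * a z y * a x y) = S"
    unfolding S_def by (intro sum.cong refl sum.swap)
  also have "(\<Sum>x<n. \<Sum>y<n. \<Sum>z<n. \<delta> y z * (a x y * a x z)) = m"
    unfolding m_def d_def by (intro sum.cong refl) (simp add: delta sq)
  finally have Q: "Q = 2 * S + m" by simp
  have "(\<Sum>y<n. (\<Sum>x<n. a x y) * d y) = (\<Sum>y<n. \<Sum>x<n. \<Sum>z<n. a x y * a y z)"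
    unfolding d_def by (simp add: sum_product)
  also have "\<dots> = (\<Sum>x<n. \<Sum>y<n. \<Sum>z<n. a x y * a y z)" by (rule sum.swap)
  \<comment> \<open>Again a factor 1, now for the ends of the walk. The case \<open>x = z\<close>
    contributes nothing because no arc occurs in both directions.\<close>
  also have "\<dots> = (\<Sum>x<n. \<Sum>y<n. \<Sum>z<n. a x y * a y z * (a x z + a z x + \<delta> x z))"
    using tot by simp
  also have "\<dots> = S + C + (\<Sum>x<n. \<Sum>y<n. \<Sum>z<n. \<delta> x z * (a x y * a y z))"
    unfolding S_def C_def by (simp add: algebra_simps sum.distrib)
  also have "(\<Sum>x<n. \<Sum>y<n. \<Sum>z<n. \<delta> x z * (a x y * a y z)) = 0"
    by (simp add: delta anti)
  also have "(\<Sum>y<n. (\<Sum>x<n. a x y) * d y) = (int n - 1) * m - Q"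
  proof -
    have "(\<Sum>y<n. (\<Sum>x<n. a x y) * d y) = (\<Sum>y<n. (int n - 1) * d y - d y * d y)"
      by (intro sum.cong refl) (simp add: ind left_diff_distrib)
    thus ?thesis unfolding m_def Q_def by (simp add: sum_subtractf sum_distrib_left)
  qed
  finally have P: "(int n - 1) * m - Q = S + C" by simp
  have C: "C = (\<Sum>x<n. \<Sum>y<n. \<Sum>z<n. of_bool (e x y \<and> e y z \<and> e z x))"
    unfolding C_def a_def by (intro sum.cong refl) auto
  have "(\<Sum>x<n. int ((outdeg n e x)\<^sup>2)) = Q"
    unfolding Q_def by (simp add: d power2_eq_square)
  moreover have "(\<Sum>x<n. int (outdeg n e x)) = m" unfolding m_def by (simp add: d)
  moreover have "2 * C + 3 * Q = (2 * int n - 1) * m" using P Q by (simp add: algebra_simps)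
  ultimately show "2 * (\<Sum>x<n. \<Sum>y<n. \<Sum>z<n. of_bool (e x y \<and> e y z \<and> e z x)) + 3 * (\<Sum>x<n. int ((outdeg n e x)\<^sup>2))
      = (2 * int n - 1) * (\<Sum>x<n. int (outdeg n e x))"
    "2 * (\<Sum>x<n. int (outdeg n e x)) = int n * (int n - 1)"
    using m C by (simp_all add: algebra_simps)
qed

lemma tour_on_less: "tour_on n (\<lambda>x y. x < y \<and> y < n)"
  unfolding tour_on_def by auto

text \<open>The usual order has outdegrees \<open>0, ..., n - 1\<close>, no cyclic triple and the
  same sum of outdegrees as \<open>e\<close>. Comparing the two counts, the sum of squares of
  \<open>e\<close> falls short by two thirds of its number of cyclic ordered triples, and a
  tournament without such triples is transitive.\<close>

lemma acyclic_iff_sum_squares: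
  assumes e: "tour_on n e"
  shows "acyclic {(x, y). e x y} \<longleftrightarrow> (\<Sum>x<n. x\<^sup>2) \<le> (\<Sum>x<n. (outdeg n e x)\<^sup>2)"
proof -
  let ?C = "\<lambda>e. (\<Sum>x<n. \<Sum>y<n. \<Sum>z<n. of_bool (e x y \<and> e y z \<and> e z x)) :: int"
  let ?L = "\<lambda>x y. x < y \<and> y < n"
  have deg: "outdeg n ?L x = n - Suc x" if "x < n" for x
  proof -
    have "outdeg n ?L x = card ({..<n} \<inter> {y. x < y \<and> y < n})"
      unfolding outdeg_def by (subst sum_of_bool_eq) auto
    also have "{..<n} \<inter> {y. x < y \<and> y < n} = {x<..<n}" by auto
    finally show ?thesis by simp
  qed
  have L: "(\<Sum>x<n. (outdeg n ?L x)\<^sup>2) = (\<Sum>x<n. x\<^sup>2)"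
    using deg sum.nat_diff_reindex[of "\<lambda>x. x\<^sup>2" n] by simp
  have "?C ?L = 0" by (intro sum.neutral ballI) auto
  with three_cycle_count[OF e] three_cycle_count[OF tour_on_less, of n] L
  have eq: "2 * ?C e + 3 * int (\<Sum>x<n. (outdeg n e x)\<^sup>2) = 3 * int (\<Sum>x<n. x\<^sup>2)"
    unfolding of_nat_sum[symmetric] by simp
  have nonneg: "0 \<le> ?C e" by (intro sum_nonneg) auto
  show ?thesis
  proof
    assume acyc: "acyclic {(x, y). e x y}"
    have no3: "\<not> (e x y \<and> e y z \<and> e z x)" for x y z
    proof
      assume "e x y \<and> e y z \<and> e z x"
      hence "(x, y) \<in> {(x, y). e x y}\<^sup>+" "(y, z) \<in> {(x, y). e x y}\<^sup>+" "(z, x) \<in> {(x, y). e x y}\<^sup>+"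
        by auto
      hence "(x, x) \<in> {(x, y). e x y}\<^sup>+" by (meson trancl_trans)
      with acyc show False by (auto simp: acyclic_def)
    qed
    have "?C e = 0" by (simp only: no3 of_bool_eq sum.neutral_const)
    with eq show "(\<Sum>x<n. x\<^sup>2) \<le> (\<Sum>x<n. (outdeg n e x)\<^sup>2)" by linarith
  next
    assume "(\<Sum>x<n. x\<^sup>2) \<le> (\<Sum>x<n. (outdeg n e x)\<^sup>2)"
    with eq nonneg have "?C e = 0" by linarith
    hence no3: "\<not> (e x y \<and> e y z \<and> e z x)" if "x < n" "y < n" "z < n" for x y z
      using that by (simp add: sum_nonneg_eq_0_iff sum_nonneg) blast
    have "trans {(x, y). e x y}"
    proof (rule transI, clarsimp)
      fix x y z assume "e x y" "e y z"
      with e no3[of x y z] show "e x z" unfolding tour_on_def by metis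
    qed
    moreover have "irrefl {(x, y). e x y}" using e unfolding tour_on_def irrefl_def by blast
    ultimately show "acyclic {(x, y). e x y}" by (simp add: acyclic_irrefl)
  qed
qed

section \<open>Labels are determined by adjacency to four vertices\<close>

text \<open>Equality with \<open>x\<close> is recorded separately, since the absence of an arc from
  \<open>v\<close> to \<open>x\<close> alone would not distinguish \<open>v = x\<close> from an arc
  in the other direction.\<close>

definition same_type :: "'a rel \<Rightarrow> 'a \<Rightarrow> 'a \<Rightarrow> 'a \<Rightarrow> bool" where
  "same_type A x v v' \<longleftrightarrow> (v = x \<longleftrightarrow> v' = x) \<and> ((v, x) \<in> A \<longleftrightarrow> (v', x) \<in> A)"

text \<open>The order given by \<open>pos\<close> is the transitive tournament obtained by inverting the sets \<open>p\<close> and \<open>q\<close>.\<close>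

locale unravelled =
  fixes n :: nat and A :: "nat rel" and p q :: "nat \<Rightarrow> bool" and pos :: "nat \<Rightarrow> nat"
  assumes pos_inj: "x < n \<Longrightarrow> y < n \<Longrightarrow> pos x = pos y \<Longrightarrow> x = y"
    and no_loop: "(x, x) \<notin> A"
    and arc: "x < n \<Longrightarrow> y < n \<Longrightarrow> x \<noteq> y \<Longrightarrow>
      (x, y) \<in> A \<longleftrightarrow> (pos x < pos y) \<noteq> ((p x \<and> p y) \<noteq> (q x \<and> q y))"
begin

lemma first_exists:
  assumes "v < n" "P v"
  obtains u where "u < n" "P u" "\<And>v. v < n \<Longrightarrow> P v \<Longrightarrow> v = u \<or> pos u < pos v"
proof -
  obtain u where "u < n \<and> P u" "\<forall>v. v < n \<and> P v \<longrightarrow> pos u \<le> pos v"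
    using ex_has_least_nat[of "\<lambda>v. v < n \<and> P v" v pos] assms by blast
  with that[of u] show thesis using pos_inj by (metis le_neq_implies_less)
qed

lemma last_exists:
  assumes "v < n" "P v"
  obtains u where "u < n" "P u" "\<And>v. v < n \<Longrightarrow> P v \<Longrightarrow> v = u \<or> pos v < pos u"
proof -
  let ?S = "pos ` {v. v < n \<and> P v}"
  have S: "finite ?S" "?S \<noteq> {}" using assms by auto
  from Max_in[OF S] obtain u where "u < n" "P u" "Max ?S = pos u" by auto
  moreover from this have "pos v \<le> pos u" if "v < n" "P v" for v
    using Max_ge[OF S(1), of "pos v"] that by auto
  ultimately show thesis using that[of u] pos_inj by (metis le_neq_implies_less)
qed

text \<open>After undoing the known inversion of \<open>p\<close>, the first and the last vertex of \<open>q\<close> reveal \<open>q\<close>.\<close>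

lemma type_determines_10:
  assumes u: "u < n" "p u" "\<not> q u" and u': "u' < n" "p u'" "\<not> q u'"
    and first: "\<And>v. v < n \<Longrightarrow> p v \<or> q v \<Longrightarrow> v = u \<or> pos u < pos v"
    and last: "\<And>v. v < n \<Longrightarrow> p v \<or> q v \<Longrightarrow> v = u' \<or> pos v < pos u'"
  shows "\<exists>w<n. \<exists>w'<n. \<forall>v<n. \<forall>v'<n. same_type A u v v' \<longrightarrow> same_type A u' v v' \<longrightarrow>
    same_type A w v v' \<longrightarrow> same_type A w' v v' \<longrightarrow> p v = p v' \<and> q v = q v'"
proof -
  \<comment> \<open>Both ends have label 10, so exactly the vertices with \<open>p\<close> have
    their arcs to them reversed. A vertex outside the range has arcs to both ends or to neither, and
    one inside without \<open>p\<close> has an arc to \<open>u'\<close> only.\<close>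
  have p_iff: "p v \<longleftrightarrow> v = u \<or> v = u' \<or> (v, u) \<in> A \<and> (v, u') \<notin> A" if "v < n" for v
    using arc[OF that u(1)] arc[OF that u'(1)] u u' first[OF that] last[OF that] first[OF u'(1)]
    by (cases "v = u"; cases "v = u'"; cases "p v"; cases "q v"; auto)
  have p_eq: "p v = p v'" if "v < n" "v' < n" "same_type A u v v'" "same_type A u' v v'" for v v'
    using p_iff[OF that(1)] p_iff[OF that(2)] that(3,4) unfolding same_type_def by blast
  show ?thesis
  proof (cases "\<exists>v<n. q v")
    case False
    thus ?thesis using u p_eq by blast
  next
    case True
    then obtain v0 where v0: "v0 < n" "q v0" by blast
    obtain w where w: "w < n" "q w" "\<And>v. v < n \<Longrightarrow> q v \<Longrightarrow> v = w \<or> pos w < pos v"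
      using first_exists[of _ q, OF v0] by blast
    obtain w' where w': "w' < n" "q w'" "\<And>v. v < n \<Longrightarrow> q v \<Longrightarrow> v = w' \<or> pos v < pos w'"
      using last_exists[of _ q, OF v0] by blast
    \<comment> \<open>Since \<open>p\<close> agrees on \<open>v\<close> and \<open>v'\<close>, equal
      arcs but different \<open>q\<close> would put \<open>v'\<close> on the other side of both
      \<open>w\<close> and \<open>w'\<close> than \<open>v\<close>, that is, before the first and
      after the last vertex of \<open>q\<close>.\<close>
    have q_imp: "q v'" if v: "v < n" "v' < n" "p v = p v'" and q: "q v"
      and same: "same_type A w v v'" "same_type A w' v v'" for v v'
    proof (rule ccontr)
      assume "\<not> q v'"
      hence ne: "v' \<noteq> w" "v' \<noteq> w'" using w w' by auto
      hence "v \<noteq> w" "v \<noteq> w'" using same unfolding same_type_def by auto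
      have "pos w < pos v" "pos v < pos w'" using w(3) w'(3) v q \<open>v \<noteq> w\<close> \<open>v \<noteq> w'\<close> by auto
      have "pos v' < pos w"
        using arc[OF v(1) w(1) \<open>v \<noteq> w\<close>] arc[OF v(2) w(1) ne(1)] same(1) v(3) q w(2) \<open>\<not> q v'\<close> \<open>pos w < pos v\<close>
        unfolding same_type_def by auto
      moreover have "\<not> pos v' < pos w'"
        using arc[OF v(1) w'(1) \<open>v \<noteq> w'\<close>] arc[OF v(2) w'(1) ne(2)] same(2) v(3) q w'(2) \<open>\<not> q v'\<close> \<open>pos v < pos w'\<close>
        unfolding same_type_def by auto
      ultimately show False using \<open>pos w < pos v\<close> \<open>pos v < pos w'\<close> by simp
    qed
    have sym: "same_type A x v v' \<Longrightarrow> same_type A x v' v" for x v v'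
      unfolding same_type_def by auto
    show ?thesis
      by (rule exI[of _ w], rule conjI[OF w(1)], rule exI[of _ w'], rule conjI[OF w'(1)])
        (use p_eq q_imp sym in \<open>metis (full_types)\<close>)
  qed
qed

text \<open>Here \<open>w\<close> is the first vertex with label 10 or 01, and \<open>w'\<close> the last one before \<open>w\<close>, which tells
  the vertices before \<open>w\<close> from those after \<open>w\<close>.\<close>

lemma type_determines_11:
  assumes u: "u < n" "p u" "q u" and u': "u' < n" "p u'" "q u'"
    and first: "\<And>v. v < n \<Longrightarrow> p v \<or> q v \<Longrightarrow> v = u \<or> pos u < pos v"
    and last: "\<And>v. v < n \<Longrightarrow> p v \<or> q v \<Longrightarrow> v = u' \<or> pos v < pos u'"
    and v0: "v0 < n" "p v0 \<noteq> q v0"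
  shows "\<exists>w<n. \<exists>w'<n. \<forall>v<n. \<forall>v'<n. same_type A u v v' \<longrightarrow> same_type A u' v v' \<longrightarrow>
    same_type A w v v' \<longrightarrow> same_type A w' v v' \<longrightarrow> p v = p v' \<and> q v = q v'"
proof -
  obtain w where w: "w < n" "p w \<noteq> q w" "\<And>v. v < n \<Longrightarrow> p v \<noteq> q v \<Longrightarrow> v = w \<or> pos w < pos v"
    using first_exists[of _ "\<lambda>v. p v \<noteq> q v", OF v0] by blast
  have "u \<noteq> w" using u w(2) by auto
  hence "pos u < pos w" using first[of w] w by auto
  \<comment> \<open>This \<open>z\<close> is the second auxiliary vertex; \<open>u\<close> shows
    that some vertex precedes \<open>w\<close>.\<close>
  then obtain z where z: "z < n" "pos z < pos w" "\<And>v. v < n \<Longrightarrow> pos v < pos w \<Longrightarrow> v = z \<or> pos v < pos z"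
    using last_exists[of _ "\<lambda>v. pos v < pos w", OF u(1)] by blast
  have pz: "p z = q z" using w(3)[OF z(1)] z(2) by auto
  \<comment> \<open>The dot product with 11 is the sum of both coordinates, so the two ends reveal
    whether the label is one of 10 and 01.\<close>
  have pq_iff: "p v \<noteq> q v \<longleftrightarrow> (v, u) \<in> A \<and> (v, u') \<notin> A" if "v < n" for v
    using arc[OF that u(1)] arc[OF that u'(1)] u u' first[OF that] last[OF that] first[OF u'(1)]
      no_loop[of u] no_loop[of u']
    by (cases "v = u"; cases "v = u'"; cases "p v"; cases "q v"; auto)
  \<comment> \<open>Labels 00 and 11 have dot product 0 with each other, so the arc between
    \<open>v\<close> and \<open>z\<close> follows the order.\<close>
  have before_iff: "pos v < pos w \<longleftrightarrow> v = z \<or> (v, z) \<in> A" if "v < n" "p v = q v" for v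
    using arc[OF that(1) z(1)] that(2) z(2) z(3)[OF that(1)] pz by (cases "v = z"; auto)
  \<comment> \<open>For a label 00 or 11 the dot product with the label of \<open>w\<close> is
    \<open>p v\<close>; once the side of \<open>w\<close> is known, the arc to \<open>w\<close>
    reveals it.\<close>
  have p_iff: "p v \<longleftrightarrow> v = z \<and> (v, w) \<notin> A \<or> v \<noteq> z \<and> ((v, z) \<in> A \<longleftrightarrow> (v, w) \<notin> A)"
    if "v < n" "p v = q v" for v
    using before_iff[OF that] arc[OF that(1) w(1)] that(2) w(2) by auto
  \<comment> \<open>Here \<open>v\<close> lies after \<open>w\<close>, so an arc from
    \<open>v\<close> to \<open>w\<close> means a reversal, that is, equal labels.\<close>
  have pw: "p v \<longleftrightarrow> p w = ((v, w) \<in> A)" if "v < n" "p v \<noteq> q v" "v \<noteq> w" for v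
    using w(3)[OF that(1,2)] arc[OF that(1) w(1)] that(2,3) w(2) by auto
  show ?thesis
  proof (rule exI[of _ w], rule conjI[OF w(1)], rule exI[of _ z], rule conjI[OF z(1)], intro allI impI)
    fix v v' assume v: "v < n" "v' < n" and same: "same_type A u v v'" "same_type A u' v v'"
      "same_type A w v v'" "same_type A z v v'"
    have pq: "p v \<noteq> q v \<longleftrightarrow> p v' \<noteq> q v'"
      using pq_iff v same(1,2) unfolding same_type_def by simp
    moreover have "p v = p v'"
    proof (cases "p v = q v")
      case True
      thus ?thesis using p_iff v pq same(3,4) unfolding same_type_def by (smt (verit))
    next
      case False
      thus ?thesis using pw[of v] pw[of v'] v pq same(3) unfolding same_type_def by auto
    qed
    ultimately show "p v = p v' \<and> q v = q v'" by auto
  qed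
qed

text \<open>On vertices of one label, \<open>A\<close> agrees with the order if the label is 00 or
  11 and with its reverse if it is 10 or 01. So the first or the last vertex, respectively, is a
  source.\<close>

lemma monochromatic_source:
  assumes "v0 < n" "P v0" and mono: "\<And>x y. P x \<Longrightarrow> P y \<Longrightarrow> p x = p y \<and> q x = q y"
  obtains w where "w < n" "P w" "\<And>v. v < n \<Longrightarrow> P v \<Longrightarrow> (v, w) \<notin> A"
proof (cases "p v0 = q v0")
  case True
  obtain w where w: "w < n" "P w" "\<And>v. v < n \<Longrightarrow> P v \<Longrightarrow> v = w \<or> pos w < pos v"
    using first_exists[of _ P, OF assms(1,2)] by blast
  have "(v, w) \<notin> A" if "v < n" "P v" for v
    using w(3)[OF that] arc[OF that(1) w(1)] mono[OF that(2) assms(2)] mono[OF w(2) assms(2)] True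
      no_loop[of w] by (cases "v = w"; auto)
  with w that show thesis by blast
next
  case False
  obtain w where w: "w < n" "P w" "\<And>v. v < n \<Longrightarrow> P v \<Longrightarrow> v = w \<or> pos v < pos w"
    using last_exists[of _ P, OF assms(1,2)] by blast
  have "(v, w) \<notin> A" if "v < n" "P v" for v
    using w(3)[OF that] arc[OF that(1) w(1)] mono[OF that(2) assms(2)] mono[OF w(2) assms(2)] False
      no_loop[of w] by (cases "v = w"; auto)
  with w that show thesis by blast
qed

lemma monochromatic_sink:
  assumes "v0 < n" "P v0" and mono: "\<And>x y. P x \<Longrightarrow> P y \<Longrightarrow> p x = p y \<and> q x = q y"
  obtains w where "w < n" "P w" "\<And>v. v < n \<Longrightarrow> P v \<Longrightarrow> v = w \<or> (v, w) \<in> A"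
proof (cases "p v0 = q v0")
  case True
  obtain w where w: "w < n" "P w" "\<And>v. v < n \<Longrightarrow> P v \<Longrightarrow> v = w \<or> pos v < pos w"
    using last_exists[of _ P, OF assms(1,2)] by blast
  have "v = w \<or> (v, w) \<in> A" if "v < n" "P v" for v
    using w(3)[OF that] arc[OF that(1) w(1)] mono[OF that(2) assms(2)] mono[OF w(2) assms(2)] True
    by (cases "v = w"; auto)
  with w that show thesis by blast
next
  case False
  obtain w where w: "w < n" "P w" "\<And>v. v < n \<Longrightarrow> P v \<Longrightarrow> v = w \<or> pos w < pos v"
    using first_exists[of _ P, OF assms(1,2)] by blast
  have "v = w \<or> (v, w) \<in> A" if "v < n" "P v" for v
    using w(3)[OF that] arc[OF that(1) w(1)] mono[OF that(2) assms(2)] mono[OF w(2) assms(2)] False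
    by (cases "v = w"; auto)
  with w that show thesis by blast
qed

text \<open>The arcs with \<open>u\<close> and \<open>u'\<close> confuse the vertices before \<open>u\<close> with those between \<open>u\<close> and \<open>u'\<close> of one
  particular label, and likewise after \<open>u'\<close>. A source \<open>w\<close> and a sink \<open>w'\<close> of these two label classes
  resolve the ambiguity.\<close>

lemma type_determines_independent:
  assumes u: "u < n" "p u \<or> q u" and u': "u' < n" "p u' \<or> q u'"
    and indep: "\<not> (p u = p u' \<and> q u = q u')"
    and first: "\<And>v. v < n \<Longrightarrow> p v \<or> q v \<Longrightarrow> v = u \<or> pos u < pos v"
    and last: "\<And>v. v < n \<Longrightarrow> p v \<or> q v \<Longrightarrow> v = u' \<or> pos v < pos u'"
  shows "\<exists>w<n. \<exists>w'<n. \<forall>v<n. \<forall>v'<n. same_type A u v v' \<longrightarrow> same_type A u' v v' \<longrightarrow>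
    same_type A w v v' \<longrightarrow> same_type A w' v v' \<longrightarrow> p v = p v' \<and> q v = q v'"
proof -
  define a where "a v \<longleftrightarrow> (p u \<and> p v) \<noteq> (q u \<and> q v)" for v
  define c where "c v \<longleftrightarrow> (p u' \<and> p v) \<noteq> (q u' \<and> q v)" for v
  \<comment> \<open>Two distinct nonzero vectors over the field with two elements are a basis, so
    the dot products \<open>a\<close> and \<open>c\<close> determine the label.\<close>
  have labels: "p v = p v' \<and> q v = q v'" if "a v = a v'" "c v = c v'" for v v'
    using that u(2) u'(2) indep unfolding a_def c_def by auto
  have "u \<noteq> u'" using indep by auto
  hence uu': "pos u < pos u'" using first[OF u'] by auto
  have before: "\<not> p v \<and> \<not> q v" if "v < n" "v \<noteq> u" "\<not> pos u < pos v" for v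
    using first[of v] that by auto
  have after: "\<not> p v \<and> \<not> q v" if "v < n" "v \<noteq> u'" "\<not> pos v < pos u'" for v
    using last[of v] that by auto
  have zero: "\<not> a v \<and> \<not> c v" if "\<not> p v \<and> \<not> q v" for v
    using that unfolding a_def c_def by auto
  \<comment> \<open>Between the two ends, \<open>E\<close> is the class with arcs to both
    \<open>u\<close> and \<open>u'\<close>, like the vertices before \<open>u\<close>, and
    \<open>E'\<close> is the class with arcs to neither, like those after \<open>u'\<close>.\<close>
  define E where "E v \<longleftrightarrow> v \<noteq> u \<and> v \<noteq> u' \<and> a v \<and> \<not> c v" for v
  define E' where "E' v \<longleftrightarrow> v \<noteq> u \<and> v \<noteq> u' \<and> \<not> a v \<and> c v" for v
  have mid: "pos u < pos v \<and> pos v < pos u'" if "v < n" "E v \<or> E' v" for v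
    using that before[of v] after[of v] zero[of v] unfolding E_def E'_def by auto
  \<comment> \<open>Vertices before \<open>u\<close> have label 0, so their arcs to a source
    \<open>w\<close> of \<open>E\<close> keep the direction of the order. If \<open>E\<close> is
    empty, \<open>u\<close> takes the place of \<open>w\<close>.\<close>
  have "\<exists>w<n. (\<forall>v<n. E v \<longrightarrow> (v, w) \<notin> A) \<and> (\<forall>v<n. pos v < pos u \<longrightarrow> (v, w) \<in> A)"
  proof (cases "\<exists>v<n. E v")
    case True
    then obtain v0 where v0: "v0 < n" "E v0" by blast
    have "p x = p y \<and> q x = q y" if "E x" "E y" for x y
      using labels[of x y] that unfolding E_def by blast
    then obtain w where w: "w < n" "E w" "\<And>v. v < n \<Longrightarrow> E v \<Longrightarrow> (v, w) \<notin> A"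
      using monochromatic_source[of v0 E] v0 by metis
    have "(v, w) \<in> A" if "v < n" "pos v < pos u" for v
      using arc[OF that(1) w(1)] before[OF that(1)] that mid[OF w(1)] w(2) by (cases "v = w"; cases "v = u"; cases "v = u'"; auto)
    with w show ?thesis by blast
  next
    case False
    have "(v, u) \<in> A" if "v < n" "pos v < pos u" for v
      using arc[OF that(1) u(1)] before[OF that(1)] that by (cases "v = u"; auto)
    with False u show ?thesis by blast
  qed
  then obtain w where w: "w < n" "\<And>v. v < n \<Longrightarrow> E v \<Longrightarrow> (v, w) \<notin> A"
    "\<And>v. v < n \<Longrightarrow> pos v < pos u \<Longrightarrow> (v, w) \<in> A" by blast
  have "\<exists>w'<n. (\<forall>v<n. E' v \<longrightarrow> v = w' \<or> (v, w') \<in> A) \<and>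
      (\<forall>v<n. pos u' < pos v \<longrightarrow> v \<noteq> w' \<and> (v, w') \<notin> A)"
  proof (cases "\<exists>v<n. E' v")
    case True
    then obtain v0 where v0: "v0 < n" "E' v0" by blast
    have "p x = p y \<and> q x = q y" if "E' x" "E' y" for x y
      using labels[of x y] that unfolding E'_def by blast
    then obtain w where w: "w < n" "E' w" "\<And>v. v < n \<Longrightarrow> E' v \<Longrightarrow> v = w \<or> (v, w) \<in> A"
      using monochromatic_sink[of v0 E'] v0 by metis
    have "v \<noteq> w \<and> (v, w) \<notin> A" if "v < n" "pos u' < pos v" for v
      using arc[OF that(1) w(1)] after[OF that(1)] that mid[OF w(1)] w(2) by (cases "v = w"; cases "v = u"; cases "v = u'"; auto)
    with w show ?thesis by blast
  next
    case False
    have "v \<noteq> u' \<and> (v, u') \<notin> A" if "v < n" "pos u' < pos v" for v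
      using arc[OF that(1) u'(1)] after[OF that(1)] that by (cases "v = u'"; auto)
    with False u' show ?thesis by blast
  qed
  then obtain w' where w': "w' < n" "\<And>v. v < n \<Longrightarrow> E' v \<Longrightarrow> v = w' \<or> (v, w') \<in> A"
    "\<And>v. v < n \<Longrightarrow> pos u' < pos v \<Longrightarrow> v \<noteq> w' \<and> (v, w') \<notin> A" by blast
  \<comment> \<open>The arcs to \<open>u\<close> and \<open>u'\<close> decide unless both are
    present or both are absent; then \<open>w\<close> or \<open>w'\<close>, respectively,
    decides.\<close>
  have a_iff: "a v \<longleftrightarrow> (v, u) \<in> A \<and> ((v, u') \<notin> A \<or> (v, w) \<notin> A)"
    and c_iff: "c v \<longleftrightarrow> (v, u') \<notin> A \<and> ((v, u) \<in> A \<or> v = w' \<or> (v, w') \<in> A)"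
    if v: "v < n" "v \<noteq> u" "v \<noteq> u'" for v
  proof -
    have ne: "pos v \<noteq> pos u" "pos v \<noteq> pos u'" using pos_inj u(1) u'(1) v by auto
    have au: "(v, u) \<in> A \<longleftrightarrow> (pos v < pos u) \<noteq> a v"
      using arc[OF v(1) u(1) v(2)] unfolding a_def by auto
    have cu: "(v, u') \<in> A \<longleftrightarrow> (pos v < pos u') \<noteq> c v"
      using arc[OF v(1) u'(1) v(3)] unfolding c_def by auto
    consider "pos v < pos u" | "pos u' < pos v" | "pos u < pos v" "pos v < pos u'"
      using ne by linarith
    hence "(a v \<longleftrightarrow> (v, u) \<in> A \<and> ((v, u') \<notin> A \<or> (v, w) \<notin> A)) \<and>
        (c v \<longleftrightarrow> (v, u') \<notin> A \<and> ((v, u) \<in> A \<or> v = w' \<or> (v, w') \<in> A))"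
    proof cases
      case 1
      thus ?thesis using au cu uu' zero[OF before[OF v(1,2)]] w(3)[OF v(1)] by auto
    next
      case 2
      thus ?thesis using au cu uu' zero[OF after[OF v(1,3)]] w'(3)[OF v(1)] by auto
    next
      case 3
      thus ?thesis using au cu v w(2)[OF v(1)] w'(2)[OF v(1)] unfolding E_def E'_def by auto
    qed
    thus "a v \<longleftrightarrow> (v, u) \<in> A \<and> ((v, u') \<notin> A \<or> (v, w) \<notin> A)"
      "c v \<longleftrightarrow> (v, u') \<notin> A \<and> ((v, u) \<in> A \<or> v = w' \<or> (v, w') \<in> A)" by auto
  qed
  show ?thesis
  proof (rule exI[of _ w], rule conjI[OF w(1)], rule exI[of _ w'], rule conjI[OF w'(1)], intro allI impI)
    fix v v' assume v: "v < n" "v' < n" and same: "same_type A u v v'" "same_type A u' v v'"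
      "same_type A w v v'" "same_type A w' v v'"
    show "p v = p v' \<and> q v = q v'"
    proof (cases "v = u \<or> v = u'")
      case True
      thus ?thesis using same(1,2) unfolding same_type_def by auto
    next
      case False
      hence "v' \<noteq> u" "v' \<noteq> u'" using same(1,2) unfolding same_type_def by auto
      with False v same show ?thesis
        by (intro labels) (simp_all add: a_iff c_iff same_type_def)
    qed
  qed
qed

lemma swapped: "unravelled n A q p pos"
  by unfold_locales (use pos_inj no_loop arc in auto)

text \<open>Some arc was reversed, so a nonzero label occurs and \<open>u\<close>, \<open>u'\<close>
  exist. The cases are distinct labels at the two ends, and the common label 10, 01 or 11, where 01
  reduces to 10 by exchanging \<open>p\<close> and \<open>q\<close>.\<close>

lemma type_determines_labels:
  assumes "\<not> (\<forall>x<n. \<forall>y<n. x \<noteq> y \<longrightarrow> ((x, y) \<in> A \<longleftrightarrow> pos x < pos y))"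
  shows "\<exists>u<n. \<exists>u'<n. \<exists>w<n. \<exists>w'<n. \<forall>v<n. \<forall>v'<n. same_type A u v v' \<longrightarrow> same_type A u' v v' \<longrightarrow>
    same_type A w v v' \<longrightarrow> same_type A w' v v' \<longrightarrow> p v = p v' \<and> q v = q v'"
proof -
  obtain x y where xy: "x < n" "y < n" "(p x \<and> p y) \<noteq> (q x \<and> q y)"
    using assms arc by blast
  hence x: "p x \<or> q x" by blast
  obtain u where u: "u < n" "p u \<or> q u" "\<And>v. v < n \<Longrightarrow> p v \<or> q v \<Longrightarrow> v = u \<or> pos u < pos v"
    using first_exists[of x "\<lambda>v. p v \<or> q v", OF xy(1) x] by blast
  obtain u' where u': "u' < n" "p u' \<or> q u'" "\<And>v. v < n \<Longrightarrow> p v \<or> q v \<Longrightarrow> v = u' \<or> pos v < pos u'"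
    using last_exists[of x "\<lambda>v. p v \<or> q v", OF xy(1) x] by blast
  consider "\<not> (p u = p u' \<and> q u = q u')" | "p u" "\<not> q u" "p u'" "\<not> q u'"
    | "\<not> p u" "q u" "\<not> p u'" "q u'" | "p u" "q u" "p u'" "q u'"
    using u(2) by blast
  thus ?thesis
  proof cases
    case 1
    from type_determines_independent[OF u(1,2) u'(1,2) 1 u(3) u'(3)] u(1) u'(1) show ?thesis by blast
  next
    case 2
    from type_determines_10[OF u(1) 2(1,2) u'(1) 2(3,4) u(3) u'(3)] u(1) u'(1) show ?thesis by blast
  next
    case 3
    interpret swap: unravelled n A q p pos by (rule swapped)
    have "\<exists>w<n. \<exists>w'<n. \<forall>v<n. \<forall>v'<n. same_type A u v v' \<longrightarrow> same_type A u' v v' \<longrightarrow>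
        same_type A w v v' \<longrightarrow> same_type A w' v v' \<longrightarrow> q v = q v' \<and> p v = p v'"
      by (rule swap.type_determines_10) (use 3 u u' in auto)
    thus ?thesis using u(1) u'(1) by blast
  next
    case 4
    \<comment> \<open>Were all labels 00 or 11, all dot products would vanish, contrary to the
      reversed arc.\<close>
    have "\<exists>v0<n. p v0 \<noteq> q v0" using xy by blast
    then obtain v0 where v0: "v0 < n" "p v0 \<noteq> q v0" by blast
    from type_determines_11[OF u(1) 4(1,2) u'(1) 4(3,4) u(3) u'(3) v0] u(1) u'(1) show ?thesis by blast
  qed
qed

end

section \<open>Labellings as functions of adjacency types\<close>

text \<open>The number of vertices from which \<open>x\<close> can be reached by a nonempty walk
  serves as \<open>pos x\<close>.\<close>

lemma acyclic_ranking:
  assumes "acyclic r" "finite r"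
  obtains pos :: "'a \<Rightarrow> nat" where "\<And>x y. (x, y) \<in> r \<Longrightarrow> pos x < pos y"
proof
  fix x y assume xy: "(x, y) \<in> r"
  have "{z. (z, x) \<in> r\<^sup>+} \<subset> {z. (z, y) \<in> r\<^sup>+}"
  proof
    show "{z. (z, x) \<in> r\<^sup>+} \<subseteq> {z. (z, y) \<in> r\<^sup>+}" using xy by (auto intro: trancl_into_trancl)
    have "x \<in> {z. (z, y) \<in> r\<^sup>+}" "x \<notin> {z. (z, x) \<in> r\<^sup>+}"
      using xy assms(1) by (auto simp: acyclic_def)
    thus "{z. (z, x) \<in> r\<^sup>+} \<noteq> {z. (z, y) \<in> r\<^sup>+}" by blast
  qed
  moreover have "finite {z. (z, y) \<in> r\<^sup>+}"
  proof (rule finite_subset)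
    show "{z. (z, y) \<in> r\<^sup>+} \<subseteq> Field r" using trancl_subset_Field2[of r] by (auto simp: Field_def dest: tranclD)
    show "finite (Field r)" using assms(2) by (rule finite_Field)
  qed
  ultimately show "card {z. (z, x) \<in> r\<^sup>+} < card {z. (z, y) \<in> r\<^sup>+}"
    by (rule psubset_card_mono[rotated])
qed

text \<open>A finite type, so there are only constantly many functions from types to labels,
  whatever \<open>n\<close> is.\<close>

type_synonym vtype = "(bool \<times> bool) \<times> (bool \<times> bool) \<times> (bool \<times> bool) \<times> (bool \<times> bool)"

definition type_over :: "nat rel \<Rightarrow> (nat \<Rightarrow> nat) \<Rightarrow> nat \<Rightarrow> vtype" where
  "type_over A \<sigma> v = ((v = \<sigma> 0, (v, \<sigma> 0) \<in> A), (v = \<sigma> 1, (v, \<sigma> 1) \<in> A),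
     (v = \<sigma> 2, (v, \<sigma> 2) \<in> A), (v = \<sigma> 3, (v, \<sigma> 3) \<in> A))"

lemma factors_through:
  assumes "\<And>x y. x \<in> S \<Longrightarrow> y \<in> S \<Longrightarrow> g x = g y \<Longrightarrow> h x = h y"
  obtains f where "\<And>x. x \<in> S \<Longrightarrow> h x = f (g x)"
proof
  fix x assume "x \<in> S"
  thus "h x = h (SOME y. y \<in> S \<and> g y = g x)"
    by (metis (mono_tags, lifting) assms someI_ex)
qed

lemma flip_cong:
  assumes "tournament {..<n} A" "\<And>x. x < n \<Longrightarrow> l x = l' x"
  shows "flip A l = flip A l'"
proof (intro ext)
  fix x y
  show "flip A l x y = flip A l' x y"
  proof (cases "x < n \<and> y < n")
    case True
    thus ?thesis using assms(2) by (simp add: flip_def)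
  next
    case False
    thus ?thesis using assms(1) unfolding flip_def tournament_def by auto
  qed
qed

lemma labelling_by_types:
  assumes T: "tournament {..<n} A" and acyc: "acyclic {(x, y). flip A l x y}" and "0 < n"
  obtains \<sigma> f where "\<And>i. i < 4 \<Longrightarrow> \<sigma> i < n" "acyclic {(x, y). flip A (\<lambda>v. f (type_over A \<sigma> v)) x y}"
proof -
  have tour: "tour_on n (flip A l)" using tour_on_flip[OF T] .
  have A: "A \<subseteq> {..<n} \<times> {..<n}" "asym A" "\<And>x y. x < n \<Longrightarrow> y < n \<Longrightarrow> x \<noteq> y \<Longrightarrow> (x, y) \<in> A \<or> (y, x) \<in> A"
    using T unfolding tournament_def total_on_def by auto
  have "finite {(x, y). flip A l x y}"
    by (rule finite_subset[of _ "{..<n} \<times> {..<n}"]) (use tour in \<open>auto simp: tour_on_def\<close>)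
  then obtain pos :: "nat \<Rightarrow> nat" where pos: "\<And>x y. flip A l x y \<Longrightarrow> pos x < pos y"
    using acyclic_ranking[OF acyc] by auto
  have flip_iff: "flip A l x y \<longleftrightarrow> pos x < pos y" "pos x \<noteq> pos y" if "x < n" "y < n" "x \<noteq> y" for x y
    using tour that pos[of x y] pos[of y x] unfolding tour_on_def by fastforce+
  interpret unravelled n A "\<lambda>x. fst (l x)" "\<lambda>x. snd (l x)" pos
  proof
    fix x y assume xy: "x < n" "y < n"
    show "x = y" if "pos x = pos y" using flip_iff(2)[OF xy] that by blast
    show "(x, y) \<in> A \<longleftrightarrow> (pos x < pos y) \<noteq> ((fst (l x) \<and> fst (l y)) \<noteq> (snd (l x) \<and> snd (l y)))"
      if "x \<noteq> y"
      using flip_iff(1)[OF xy that] A(2) A(3)[OF xy that] unfolding flip_def label_dot_def asym_iff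
      by (auto split: if_splits)
  qed (use A(2) in \<open>auto simp: asym_iff\<close>)
  show thesis
  proof (cases "\<forall>x<n. \<forall>y<n. x \<noteq> y \<longrightarrow> ((x, y) \<in> A \<longleftrightarrow> pos x < pos y)")
    case True
    have "{(x, y). flip A (\<lambda>v. (False, False)) x y} \<subseteq> inv_image less_than pos"
      using True A(1) no_loop unfolding flip_def label_dot_def by fastforce
    hence "acyclic {(x, y). flip A (\<lambda>v. (False, False)) x y}"
      by (meson acyclic_subset wf_acyclic wf_inv_image wf_less_than)
    thus thesis using that[of "\<lambda>_. 0" "\<lambda>_. (False, False)"] \<open>0 < n\<close> by simp
  next
    case False
    from type_determines_labels[OF this] obtain u u' w w' where
      vs: "u < n" "u' < n" "w < n" "w' < n" and
      types: "\<And>v v'. v < n \<Longrightarrow> v' < n \<Longrightarrow> same_type A u v v' \<Longrightarrow> same_type A u' v v' \<Longrightarrow>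
        same_type A w v v' \<Longrightarrow> same_type A w' v v' \<Longrightarrow> fst (l v) = fst (l v') \<and> snd (l v) = snd (l v')"
      by blast
    define \<sigma> where "\<sigma> i = [u, u', w, w'] ! i" for i
    have \<sigma>: "\<sigma> i < n" if "i < 4" for i
      using that vs unfolding \<sigma>_def by (auto simp: less_Suc_eq numeral_eq_Suc)
    have "l v = l v'" if "v \<in> {..<n}" "v' \<in> {..<n}" "type_over A \<sigma> v = type_over A \<sigma> v'" for v v'
      using types[of v v'] that unfolding type_over_def same_type_def \<sigma>_def by (simp add: prod_eq_iff)
    then obtain f where f: "\<And>v. v \<in> {..<n} \<Longrightarrow> l v = f (type_over A \<sigma> v)"
      using factors_through[of "{..<n}" "type_over A \<sigma>" l] by blast
    have "flip A l = flip A (\<lambda>v. f (type_over A \<sigma> v))"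
      by (rule flip_cong[OF T]) (simp add: f)
    with acyc show thesis using that[of \<sigma> f] \<sigma> by simp
  qed
qed

section \<open>The program\<close>

text \<open>A value of a finite type is represented by the indicators of all its possible values,
  because the machine expressions are numerical.\<close>

definition definable :: "nat \<Rightarrow> nat \<Rightarrow> (nat \<Rightarrow> nat rel \<Rightarrow> (nat \<Rightarrow> nat) \<Rightarrow> 'b :: finite) \<Rightarrow> bool" where
  "definable d q L \<longleftrightarrow> (\<forall>b. computable d q (\<lambda>n A \<sigma>. of_bool (L n A \<sigma> = b)))"

lemma computable_finite_sum:
  assumes "finite S" "\<And>i. i \<in> S \<Longrightarrow> computable d q (F i)"
  shows "computable d q (\<lambda>n A \<sigma>. \<Sum>i\<in>S. F i n A \<sigma>)"
  using assms by (induction S rule: finite_induct) (auto intro: computable_const computable_add)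

lemma computable_of_bool: "definable d q P \<Longrightarrow> computable d q (\<lambda>n A \<sigma>. of_bool (P n A \<sigma>))"
  unfolding definable_def by (drule spec[of _ True]) simp

text \<open>The indicator of a value of \<open>h\<close> is the sum of indicators over its fibre.
  The sum has fixed length and is unrolled in the program, so every table lookup costs only a
  constant factor.\<close>

lemma definable_comp:
  assumes "definable d q L"
  shows "definable d q (\<lambda>n A \<sigma>. h (L n A \<sigma>))"
  unfolding definable_def
proof
  fix b
  have "(of_bool (h (L n A \<sigma>) = b) :: nat) = (\<Sum>a\<in>{a. h a = b}. of_bool (L n A \<sigma> = a))" for n A \<sigma>
    by (simp add: of_bool_def)
  moreover have "computable d q (\<lambda>n A \<sigma>. \<Sum>a\<in>{a. h a = b}. of_bool (L n A \<sigma> = a))"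
    using assms unfolding definable_def by (intro computable_finite_sum) auto
  ultimately show "computable d q (\<lambda>n A \<sigma>. of_bool (h (L n A \<sigma>) = b))" by simp
qed

lemma definable_Pair:
  assumes "definable d q L" "definable d q K"
  shows "definable d q (\<lambda>n A \<sigma>. (L n A \<sigma>, K n A \<sigma>))"
  unfolding definable_def
proof
  fix b
  have "(of_bool ((L n A \<sigma>, K n A \<sigma>) = b) :: nat) = of_bool (L n A \<sigma> = fst b) * of_bool (K n A \<sigma> = snd b)" for n A \<sigma>
    by (cases b) simp
  thus "computable d q (\<lambda>n A \<sigma>. of_bool ((L n A \<sigma>, K n A \<sigma>) = b))"
    using assms computable_mult unfolding definable_def by simp
qed

lemma computable_not:
  assumes "computable d q (\<lambda>n A \<sigma>. of_bool (P n A \<sigma>))"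
  shows "computable d q (\<lambda>n A \<sigma>. of_bool (\<not> P n A \<sigma>))"
proof -
  have "(of_bool (\<not> P n A \<sigma>) :: nat) = of_bool ((of_bool (P n A \<sigma>) :: nat) < 1)" for n A \<sigma> by simp
  thus ?thesis using computable_less[OF assms computable_const[of d q 1]] by presburger
qed

lemma definableI:
  assumes "computable d q (\<lambda>n A \<sigma>. of_bool (P n A \<sigma>))"
  shows "definable d q P"
  unfolding definable_def
proof
  fix b show "computable d q (\<lambda>n A \<sigma>. of_bool (P n A \<sigma> = b))"
    using assms computable_not[OF assms] by (cases b) simp_all
qed

lemma definable_arc: "i < d \<Longrightarrow> j < d \<Longrightarrow> definable d q (\<lambda>n A \<sigma>. (\<sigma> i, \<sigma> j) \<in> A)"
  by (intro definableI computable_arc)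

lemma definable_eq:
  assumes "i < d" "j < d"
  shows "definable d q (\<lambda>n A \<sigma>. \<sigma> i = \<sigma> j)"
proof (rule definableI)
  have "(of_bool (\<sigma> i = \<sigma> j) :: nat) = of_bool (of_bool (\<sigma> i < \<sigma> j) + of_bool (\<sigma> j < \<sigma> i) < (1 :: nat))"
    for \<sigma> :: "nat \<Rightarrow> nat" by auto
  moreover have "computable d q (\<lambda>n A \<sigma>. of_bool (of_bool (\<sigma> i < \<sigma> j) + of_bool (\<sigma> j < \<sigma> i) < (1 :: nat)))"
    by (intro computable_less computable_add computable_const computable_var assms)
  ultimately show "computable d q (\<lambda>n A \<sigma>. of_bool (\<sigma> i = \<sigma> j))" by presburger
qed

lemma definable_type_over:
  assumes "4 \<le> d" "i < d"
  shows "definable d q (\<lambda>n A \<sigma>. type_over A \<sigma> (\<sigma> i))"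
  unfolding type_over_def using assms
  by (intro definable_Pair definable_eq definable_arc) auto

lemma definable_flip:
  assumes "4 \<le> d" "i < d" "j < d"
  shows "definable d q (\<lambda>n A \<sigma>. flip A (\<lambda>v. f (type_over A \<sigma> v)) (\<sigma> i) (\<sigma> j))"
proof -
  have "definable d q (\<lambda>n A \<sigma>. (\<lambda>(s, t, a, b). if label_dot (f s) (f t) then b else a)
      (type_over A \<sigma> (\<sigma> i), type_over A \<sigma> (\<sigma> j), (\<sigma> i, \<sigma> j) \<in> A, (\<sigma> j, \<sigma> i) \<in> A))"
    by (rule definable_comp) (intro definable_Pair definable_type_over definable_arc assms)
  thus ?thesis by (simp add: flip_def)
qed

section \<open>Testing one labelling rule and searching for a suitable one\<close>

definition transitive_by_types :: "(vtype \<Rightarrow> bool \<times> bool) \<Rightarrow> nat \<Rightarrow> nat rel \<Rightarrow> (nat \<Rightarrow> nat) \<Rightarrow> bool" where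
  "transitive_by_types f n A \<sigma> \<longleftrightarrow>
     (\<Sum>x<n. x\<^sup>2) \<le> (\<Sum>x<n. (outdeg n (flip A (\<lambda>v. f (type_over A \<sigma> v))) x)\<^sup>2)"

lemma type_over_upd: "4 \<le> d \<Longrightarrow> type_over A (\<sigma>(d := x)) = type_over A \<sigma>"
  unfolding type_over_def by (intro ext) simp

lemma computable_sum_over:
  assumes "computable (Suc d) q (\<lambda>n A \<sigma>. G n A \<sigma> (\<sigma> d))"
    and "\<And>n A \<sigma> x y. G n A (\<sigma>(d := y)) x = G n A \<sigma> x"
  shows "computable d (Suc q) (\<lambda>n A \<sigma>. \<Sum>x<n. G n A \<sigma> x)"
  using computable_sum_vertices[OF assms(1)] by (simp add: assms(2))

text \<open>Variables 0 to 3 hold the quadruple, variable 4 the vertex whose outdegree is squared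
  and variable 5 its candidate outneighbours; only the last two are loops here.\<close>

lemma computable_transitive_by_types:
  "computable 4 2 (\<lambda>n A \<sigma>. of_bool (transitive_by_types f n A \<sigma>))"
proof -
  let ?e = "\<lambda>A \<sigma>. flip A (\<lambda>v. f (type_over A \<sigma> v))"
  have "computable (Suc 5) 0 (\<lambda>n A \<sigma>. of_bool (?e A \<sigma> (\<sigma> 4) (\<sigma> 5)))"
    by (intro computable_of_bool definable_flip) auto
  hence "computable 5 (Suc 0) (\<lambda>n A \<sigma>. outdeg n (?e A \<sigma>) (\<sigma> 4))"
    unfolding outdeg_def by (rule computable_sum_over) (simp add: type_over_upd fun_upd_other del: fun_upd_apply)
  hence "computable (Suc 4) 1 (\<lambda>n A \<sigma>. outdeg n (?e A \<sigma>) (\<sigma> 4))" by simp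
  hence "computable (Suc 4) 1 (\<lambda>n A \<sigma>. (outdeg n (?e A \<sigma>) (\<sigma> 4))\<^sup>2)"
    unfolding power2_eq_square by (intro computable_mult)
  hence F: "computable 4 (Suc 1) (\<lambda>n A \<sigma>. \<Sum>x<n. (outdeg n (?e A \<sigma>) x)\<^sup>2)"
    by (rule computable_sum_over) (simp add: type_over_upd del: fun_upd_apply)
  have "computable (Suc 4) 1 (\<lambda>n A \<sigma>. (\<sigma> 4)\<^sup>2)"
    unfolding power2_eq_square by (intro computable_mult computable_var) simp_all
  hence G: "computable 4 (Suc 1) (\<lambda>n A \<sigma>. \<Sum>x<n. x\<^sup>2)"
    by (rule computable_sum_over) simp
  show ?thesis
    using computable_not[OF computable_less[OF F G]]
    by (simp add: transitive_by_types_def not_less numeral_2_eq_2)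
qed

text \<open>A witness exists exactly if the number of witnesses is positive.\<close>

lemma computable_ex_vertex:
  assumes "computable (Suc d) q (\<lambda>n A \<sigma>. of_bool (P n A \<sigma>))"
  shows "computable d (Suc q) (\<lambda>n A \<sigma>. of_bool (\<exists>x<n. P n A (\<sigma>(d := x))))"
proof -
  have "computable d (Suc q) (\<lambda>n A \<sigma>. of_bool (0 < (\<Sum>x<n. of_bool (P n A (\<sigma>(d := x))) :: nat)))"
    by (intro computable_less computable_const computable_sum_vertices assms)
  moreover have "0 < (\<Sum>x<n. of_bool (P n A (\<sigma>(d := x))) :: nat) \<longleftrightarrow> (\<exists>x<n. P n A (\<sigma>(d := x)))" for n A \<sigma>
    by (simp only: neq0_conv[symmetric] sum_eq_0_iff finite_lessThan) auto
  ultimately show ?thesis by (simp only:)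
qed

lemma computable_ex_assignment:
  assumes "computable d q (\<lambda>n A \<sigma>. of_bool (P n A \<sigma>))"
  shows "computable 0 (q + d) (\<lambda>n A \<sigma>. of_bool (\<exists>\<tau>. (\<forall>i<d. \<tau> i < n) \<and> P n A (\<lambda>i. if i < d then \<tau> i else \<sigma> i)))"
  using assms
proof (induction d arbitrary: q P)
  case 0
  thus ?case by simp
next
  case (Suc d)
  have "(\<exists>\<tau>. (\<forall>i<d. \<tau> i < n) \<and> (\<exists>x<n. P n A ((\<lambda>i. if i < d then \<tau> i else \<sigma> i)(d := x)))) \<longleftrightarrow>
      (\<exists>\<tau>. (\<forall>i<Suc d. \<tau> i < n) \<and> P n A (\<lambda>i. if i < Suc d then \<tau> i else \<sigma> i))" (is "?L \<longleftrightarrow> ?R") for n A \<sigma>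
  proof
    assume ?L
    then obtain \<tau> x where \<tau>: "\<forall>i<d. \<tau> i < n" "x < n" "P n A ((\<lambda>i. if i < d then \<tau> i else \<sigma> i)(d := x))" by blast
    moreover have "(\<lambda>i. if i < Suc d then (\<tau>(d := x)) i else \<sigma> i) = (\<lambda>i. if i < d then \<tau> i else \<sigma> i)(d := x)"
      by (auto simp: less_Suc_eq)
    moreover have "\<forall>i<Suc d. (\<tau>(d := x)) i < n" using \<tau> by (auto simp: less_Suc_eq)
    ultimately show ?R by (intro exI[of _ "\<tau>(d := x)"]) simp
  next
    assume ?R
    then obtain \<tau> where \<tau>: "\<forall>i<Suc d. \<tau> i < n" "P n A (\<lambda>i. if i < Suc d then \<tau> i else \<sigma> i)" by blast
    moreover have "(\<lambda>i. if i < Suc d then \<tau> i else \<sigma> i) = (\<lambda>i. if i < d then \<tau> i else \<sigma> i)(d := \<tau> d)"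
      by (auto simp: less_Suc_eq)
    ultimately show ?L by (intro exI[of _ \<tau>] conjI exI[of _ "\<tau> d"]) simp_all
  qed
  with Suc.IH[OF computable_ex_vertex[OF Suc.prems]] show ?case by (simp only: add_Suc add_Suc_right)
qed

text \<open>The empty tournament is acyclic but has no quadruple of vertices, hence the separate
  case.\<close>

lemma inv_number_le_2_iff_types:
  assumes T: "tournament {..<n} A"
  shows "inv_number {..<n} A \<le> 2 \<longleftrightarrow>
    n = 0 \<or> (\<exists>\<tau>. (\<forall>i<4. \<tau> i < n) \<and> (\<exists>f. transitive_by_types f n A \<tau>))"
proof -
  have trans_iff: "transitive_by_types f n A \<tau> \<longleftrightarrow> acyclic {(x, y). flip A (\<lambda>v. f (type_over A \<tau> v)) x y}" for f \<tau>
    unfolding transitive_by_types_def using acyclic_iff_sum_squares[OF tour_on_flip[OF T]] by simp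
  show ?thesis
  proof (cases "n = 0")
    case True
    hence "A = {}" using T by (auto simp: tournament_def)
    hence "acyclic {(x, y). flip A l x y}" for l by (simp add: flip_def acyclic_def)
    thus ?thesis using inv_number_le_2_iff[OF T] True by blast
  next
    case False
    thus ?thesis unfolding inv_number_le_2_iff[OF T] trans_iff
      using labelling_by_types[OF T] by (metis not_gr_zero)
  qed
qed

lemma computable_inv_number_le_2:
  "computable 0 6 (\<lambda>n A \<sigma>. of_bool (n = 0 \<or> (\<exists>\<tau>. (\<forall>i<4. \<tau> i < n) \<and> (\<exists>f. transitive_by_types f n A \<tau>))))"
proof -
  have "computable 4 2 (\<lambda>n A \<sigma>. of_bool (0 < (\<Sum>f\<in>UNIV. of_bool (transitive_by_types f n A \<sigma>) :: nat)))"
    by (intro computable_less computable_const computable_finite_sum computable_transitive_by_types) simp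
  moreover have "0 < (\<Sum>f\<in>UNIV. of_bool (transitive_by_types f n A \<sigma>) :: nat) \<longleftrightarrow>
      (\<exists>f. transitive_by_types f n A \<sigma>)" for n A \<sigma>
    by (simp only: neq0_conv[symmetric] sum_eq_0_iff finite) auto
  ultimately have "computable 4 2 (\<lambda>n A \<sigma>. of_bool (\<exists>f. transitive_by_types f n A \<sigma>))" by (simp only:)
  from computable_ex_assignment[OF this]
  have "computable 0 6 (\<lambda>n A \<sigma>. of_bool (\<exists>\<tau>. (\<forall>i<4. \<tau> i < n) \<and>
      (\<exists>f. transitive_by_types f n A (\<lambda>i. if i < 4 then \<tau> i else \<sigma> i))))" by simp
  moreover have "transitive_by_types f n A (\<lambda>i. if i < 4 then \<tau> i else \<sigma> i) = transitive_by_types f n A \<tau>" for f n A \<tau> \<sigma>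
    unfolding transitive_by_types_def type_over_def by simp
  ultimately have "definable 0 6 (\<lambda>n A \<sigma>. \<exists>\<tau>. (\<forall>i<4. \<tau> i < n) \<and> (\<exists>f. transitive_by_types f n A \<tau>))"
    by (intro definableI) (simp only:)
  \<comment> \<open>Emptiness is tested as the absence of a vertex, since \<open>n\<close> itself is
    not among the computable expressions provided.\<close>
  moreover have "definable 0 6 (\<lambda>n A \<sigma>. \<exists>x<n. True)"
    using computable_ex_vertex[of 0 5 "\<lambda>_ _ _. True"] computable_const[of _ _ "of_bool True"]
    by (intro definableI) simp
  ultimately have "definable 0 6 (\<lambda>n A \<sigma>. (\<lambda>(a, b). \<not> b \<or> a)
      (\<exists>\<tau>. (\<forall>i<4. \<tau> i < n) \<and> (\<exists>f. transitive_by_types f n A \<tau>), \<exists>x<n. True))"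
    by (intro definable_comp[OF definable_Pair])
  moreover have "(case (a, \<exists>x<n. True) of (a, b) \<Rightarrow> \<not> b \<or> a) \<longleftrightarrow> n = 0 \<or> a" for a and n :: nat
    by auto
  ultimately show ?thesis by (intro computable_of_bool) (simp only:)
qed

theorem theorem6p5:
  shows "\<exists>(p :: ram) (k :: nat) (f :: nat \<Rightarrow> nat).
    (\<lambda>n. real (f n)) \<in> O(\<lambda>n. real n ^ 6) \<and>
    (\<forall>(n :: nat) (A :: nat rel). tournament {..<n} A \<longrightarrow>
      (\<exists>t s. exec ((n + 2) ^ k) p (input_state n A) t s \<and> t \<le> f n \<and>
        fst s 0 = (if inv_number {..<n} A \<le> 2 then 1 else 0)))"
proof -
  let ?F = "\<lambda>(n :: nat) A. of_bool (n = 0 \<or> (\<exists>\<tau>. (\<forall>i<4. \<tau> i < n) \<and> (\<exists>f. transitive_by_types f n A \<tau>))) :: nat"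
  obtain b c p where
    bF: "\<And>(n :: nat) A (\<sigma> :: nat \<Rightarrow> nat). (\<And>i. i < 0 \<Longrightarrow> \<sigma> i < n) \<Longrightarrow> ?F n A < (n + 2) ^ b" and
    pF: "\<And>(n :: nat) A (\<sigma> :: nat \<Rightarrow> nat) k B. (\<And>i. i < 0 \<Longrightarrow> \<sigma> i < n) \<Longrightarrow> (n + 2) ^ b \<le> B \<Longrightarrow>
      computes (p k) 0 k B n A \<sigma> (?F n A) (c * (n + 1) ^ 6)"
    by (rule computableE[OF computable_inv_number_le_2]) blast
  \<comment> \<open>The last two instructions move the answer from the stack to register 0; they
    account for the 2 in the time bound.\<close>
  let ?p = "Seq (p 0) (Seq (Const 0 0) (Add 0 0 (tmp_reg 0)))"
  show ?thesis
  proof (rule exI[of _ ?p], rule exI[of _ b], rule exI[of _ "\<lambda>n. c * (n + 1) ^ 6 + 2"],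
      intro conjI allI impI)
    have "eventually (\<lambda>n. norm (real (c * (n + 1) ^ 6 + 2)) \<le> (real c * 2 ^ 6 + 2) * norm (real n ^ 6)) at_top"
      using eventually_ge_at_top[of 1]
    proof eventually_elim
      case (elim n)
      have "(real n + 1) ^ 6 \<le> (2 * real n) ^ 6" using elim by (intro power_mono) auto
      hence "real c * (real n + 1) ^ 6 \<le> real c * (2 * real n) ^ 6" by (rule mult_left_mono) simp
      moreover have "1 \<le> real n ^ 6" using elim by (simp add: one_le_power)
      ultimately have "real c * (real n + 1) ^ 6 + 2 \<le> real c * (2 * real n) ^ 6 + 2 * real n ^ 6" by linarith
      thus ?case by (simp add: power_mult_distrib algebra_simps)
    qed
    thus "(\<lambda>n. real (c * (n + 1) ^ 6 + 2)) \<in> O(\<lambda>n. real n ^ 6)" by (rule bigoI)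
  next
    fix n :: nat and A :: "nat rel"
    assume T: "tournament {..<n} A"
    let ?B = "(n + 2) ^ b" and ?M = "adj_mem n A"
    define R where "R = fst (input_state n A)"
    have "R 0 = n" unfolding R_def input_state_def by simp
    have F_less: "?F n A < ?B" by (rule bF[of "\<lambda>_. 0"]) simp
    have comp: "computes (p 0) 0 0 ?B n A (\<lambda>_. 0) (?F n A) (c * (n + 1) ^ 6)" by (rule pF) simp_all
    obtain t R' where R': "exec ?B (p 0) (R, ?M) t (R', ?M)" "t \<le> c * (n + 1) ^ 6" "R' (tmp_reg 0) = ?F n A"
      by (rule computesD[OF comp, of R]) (use \<open>R 0 = n\<close> in auto)
    let ?R = "R'(0 := 0)"
    have "exec ?B ?p (R, ?M) (t + (1 + 1)) (?R(0 := ?R 0 + ?R (tmp_reg 0)), ?M)"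
      using R'(3) F_less by (intro exec.Seq[OF R'(1) exec.Seq[OF exec.Const exec.Add]]) auto
    moreover have "(R, ?M) = input_state n A" unfolding R_def by simp
    moreover have "?F n A = (if inv_number {..<n} A \<le> 2 then 1 else 0)"
      using inv_number_le_2_iff_types[OF T] by simp
    ultimately show "\<exists>t s. exec ?B ?p (input_state n A) t s \<and> t \<le> c * (n + 1) ^ 6 + 2 \<and>
        fst s 0 = (if inv_number {..<n} A \<le> 2 then 1 else 0)"
      using R'(2,3) by (intro exI[of _ "t + (1 + 1)"] conjI
          exI[of _ "(?R(0 := ?R 0 + ?R (tmp_reg 0)), ?M)"]) simp_all
  qed
qed

end
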